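(* Let $d\ge 1$, $T>0$, $\Omega=(0,1)$, and let $L,H,\Phi,\Psi$ satisfy the standing assumptions (listed in the context), including the smallness condition on $T$. Let $X_*\in\mathbb{H}=L^2((0,1);\mathbb{R}^d)$ be prescribed. Suppose $u:[0,T]\times\mathbb{R}^d\to\mathbb{R}$ and $X:[0,T]\times\Omega\to\mathbb{R}^d$ are of class $C^1$, $\nabla_{qq}u$ is bounded, and $$\begin{cases}\partial_tu(t,q)+H(q,\nabla_qu(t,q))-\int_\Omega\Phi(q-X(t,\omega))\,d\omega=0,\\ \dot X(t,\omega)=\nabla_pH\big(X(t,\omega),\nabla_qu(t,X(t,\omega))\big),\\ u(0,q)=\int_\Omega\Psi(q-X(0,\omega))\,d\omega,\\ X(T,\omega)=X_*(\omega).\end{cases}$$ If $X_*$ is non-atomic, i.e. $\{\omega\in\Omega:X_*(\omega)=q\}$ has Lebesgue measure zero for every $q\in\mathbb{R}^d$, then the game (described in the context) admits a unique Nash equilibrium.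
   Context: Standing assumptions. $L,H\in C^3(\mathbb{R}^{2d})$, written $L(q,v)$ and $H(q,p)$ with $q,v,p\in\mathbb{R}^d$, are Legendre transforms of each other in the second variable: $H(q,p)=\sup_v\{\langle v,p\rangle-L(q,v)\}$ and $L(q,v)=\sup_p\{\langle v,p\rangle-H(q,p)\}$. $L\ge 0$, and there are $c_0,c_1>0$ with $c_0|v|^2\le L(q,v)$ and $|\nabla_qL(q,v)|\le c_1$ for all $q,v$. There is $\lambda_0>0$ such that for all $q_0,q_1,v_0,v_1\in\mathbb{R}^d$ and $\varepsilon\in[0,1]$, $\lambda_0|v_1-v_0|^2\le\frac{d^2}{d\varepsilon^2}L((1-\varepsilon)q_0+\varepsilon q_1,(1-\varepsilon)v_0+\varepsilon v_1)$. $\Phi,\Psi\in C^3(\mathbb{R}^d)$ are real-valued, even, bounded from below, with bounded first, second and third derivatives, and $c_\Phi,c_\Psi\in\mathbb{R}$ satisfy $c_\Phi I_d\le\nabla^2\Phi$, $c_\Psi I_d\le\nabla^2\Psi$. With $c^-=\max\{-c,0\}$, the smallness condition on $T$ is $$T^2\left(c_\Phi^-+2\|\nabla^2\Phi\|_{L^\infty}\right)+T\left(c_\Psi^-+2\|\nabla^2\Psi\|_{L^\infty}\right)<\frac{\lambda_0}{2}.$$ It is part of the setting that $\hat L(X,V)=\int_\Omega L(X(\omega),V(\omega))\,d\omega+\frac12\int_{\Omega^2}\Phi(X(\omega)-X(\tilde\omega))\,d\omega\,d\tilde\omega$ is a real-valued functional on $\mathbb{H}^2$. The game. Players are labelled by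 $\omega\in\Omega$, and $X_*$ gives their final positions; a player $q\in\mathbb{R}^d$ is identified with a label $\omega_0\in\Omega$ through $q=X_*(\omega_0)$. A collective control is a map $\alpha:[0,T]\times\Omega\to\mathbb{R}^d$ assigning to each player a control (velocity); its collective trajectories $X^\alpha$ satisfy $\dot X^\alpha=\alpha$ and $X^\alpha(T,\cdot)=X_*$. Given a collective control $\alpha$, a player $q=X_*(\omega_0)$ and a control $A:[0,T]\to\mathbb{R}^d$, let $\alpha^A(t,\omega)=A(t)$ if $X_*(\omega)=X_*(\omega_0)$ and $\alpha^A(t,\omega)=\alpha(t,\omega)$ if $X_*(\omega)\ne X_*(\omega_0)$ (player $q$ uses control $A$, all other players keep $\alpha$). The cost of player $q$ is $$J[T,q,A,\alpha^A]=\int_0^TL\big(X^{\alpha^A}(t,\omega_0),\alpha^A(t,\omega_0)\big)dt+\int_0^T\!\!\int_\Omega\Phi\big(X^{\alpha^A}(t,\omega_0)-X^{\alpha^A}(t,\omega)\big)d\omega\,dt+\int_\Omega\Psi\big(q-X^{\alpha^A}(0,\omega)\big)d\omega .$$ A collective control $\alpha$ is a Nash equilibrium if $$J[T,q,\alpha(\cdot,\omega_0),\alpha]\le J[T,q,A,\alpha^A]\qquad\text{for all } q\in\mathbb{R}^d\ (\text{with } q=X_*(\omega_0),\ \omega_0\in\Omega)\text{ and all Lebesgue-measurable } A:[0,T]\to\mathbb{R}^d .$$ *)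

theory Defs
  imports "HOL-Analysis.Analysis"
begin

section \<open>Differential calculus\<close>

text \<open>Functions of class \<open>C^k\<close> on \<open>S\<close>, by recursion on directional derivatives of the
  total derivative. Derivatives are taken within \<open>S\<close>; they are unique for the sets used here (the
  whole space, \<open>{0..T} \<times> UNIV\<close>, \<open>{0..T} \<times> {0<..<1}\<close>), so this is \<open>C^k\<close> up to the part of the
  boundary that belongs to \<open>S\<close>.\<close>

primrec Ck_on :: "nat \<Rightarrow> ('a::euclidean_space \<Rightarrow> 'b::euclidean_space) \<Rightarrow> 'a set \<Rightarrow> bool" where
  "Ck_on 0 f S \<longleftrightarrow> continuous_on S f"
| "Ck_on (Suc k) f S \<longleftrightarrow>
    (\<exists>f'. (\<forall>x\<in>S. (f has_derivative f' x) (at x within S)) \<and> (\<forall>h. Ck_on k (\<lambda>x. f' x h) S))"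

definition grad :: "('a::euclidean_space \<Rightarrow> real) \<Rightarrow> 'a \<Rightarrow> 'a" where
  "grad f x = (THE D. GDERIV f x :> D)"

definition hess :: "('a::euclidean_space \<Rightarrow> real) \<Rightarrow> 'a \<Rightarrow> 'a \<Rightarrow> 'a" where
  "hess f x = frechet_derivative (grad f) (at x)"

text \<open>The \<open>L\<^sup>\<infinity>\<close> norm of a continuous Hessian, with the operator norm on matrices; by continuity
  the essential supremum is the supremum.\<close>

definition hess_Linf :: "('a::euclidean_space \<Rightarrow> real) \<Rightarrow> real" where
  "hess_Linf f = (SUP x. onorm (hess f x))"

primrec iter_deriv :: "'a::euclidean_space list \<Rightarrow> ('a \<Rightarrow> real) \<Rightarrow> 'a \<Rightarrow> real" where
  "iter_deriv [] f = f"
| "iter_deriv (h # hs) f = iter_deriv hs (\<lambda>x. frechet_derivative f (at x) h)"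

definition bounded_kth_derivative :: "nat \<Rightarrow> ('a::euclidean_space \<Rightarrow> real) \<Rightarrow> bool" where
  "bounded_kth_derivative k f \<longleftrightarrow>
    (\<exists>C. \<forall>hs x. length hs = k \<longrightarrow> \<bar>iter_deriv hs f x\<bar> \<le> C * prod_list (map norm hs))"

section \<open>Standing assumptions on the data\<close>

text \<open>\<open>g(q, \<cdot>)\<close> is the Legendre transform of \<open>f(q, \<cdot>)\<close>; the supremum is taken in the extended reals,
  so the equation includes its finiteness.\<close>

definition legendre_snd :: "('a::euclidean_space \<times> 'a \<Rightarrow> real) \<Rightarrow> ('a \<times> 'a \<Rightarrow> real) \<Rightarrow> bool" where
  "legendre_snd f g \<longleftrightarrow> (\<forall>q p. ereal (g (q, p)) = (SUP v. ereal (inner v p - f (q, v))))"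

definition lagrangian_conditions ::
    "('a::euclidean_space \<times> 'a \<Rightarrow> real) \<Rightarrow> real \<Rightarrow> real \<Rightarrow> real \<Rightarrow> bool" where
  "lagrangian_conditions L c0 c1 lam0 \<longleftrightarrow>
    c0 > 0 \<and> c1 > 0 \<and> lam0 > 0 \<and>
    (\<forall>z. L z \<ge> 0) \<and>
    (\<forall>q v. c0 * (norm v)\<^sup>2 \<le> L (q, v)) \<and>
    (\<forall>q v. norm (grad (\<lambda>y. L (y, v)) q) \<le> c1) \<and>
    (\<forall>q0 q1 v0 v1. \<forall>e\<in>{0..1}.
       lam0 * (norm (v1 - v0))\<^sup>2
         \<le> (deriv ^^ 2) (\<lambda>s. L ((1 - s) *\<^sub>R q0 + s *\<^sub>R q1, (1 - s) *\<^sub>R v0 + s *\<^sub>R v1)) e)"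

definition potential_conditions :: "('a::euclidean_space \<Rightarrow> real) \<Rightarrow> real \<Rightarrow> bool" where
  "potential_conditions F c \<longleftrightarrow>
    Ck_on 3 F UNIV \<and>
    (\<forall>x. F (- x) = F x) \<and>
    bdd_below (range F) \<and>
    (\<forall>k\<in>{1, 2, 3}. bounded_kth_derivative k F) \<and>
    (\<forall>x h. c * (norm h)\<^sup>2 \<le> inner (hess F x h) h)"

abbreviation negpart :: "real \<Rightarrow> real" where
  "negpart c \<equiv> max (- c) 0"

abbreviation Omega :: "real set" where
  "Omega \<equiv> {0<..<1}"

text \<open>The Hilbert space \<open>L\<^sup>2((0,1); \<real>\<^sup>d)\<close>, by representatives: labels matter pointwise in the game.\<close>

definition L2_Omega :: "(real \<Rightarrow> 'a::euclidean_space) set" where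
  "L2_Omega = {X. X \<in> borel_measurable (lebesgue_on Omega) \<and>
                  integrable (lebesgue_on Omega) (\<lambda>w. (norm (X w))\<^sup>2)}"

text \<open>The functional
  \<open>(X, V) \<mapsto> \<integral> L(X, V) + 1/2 \<integral>\<integral> \<Phi>(X(w) - X(w'))\<close> is real-valued. Both integrands are bounded below on
  a finite measure space, so this is integrability of each of them.\<close>

definition lifted_lagrangian_finite ::
    "('a::euclidean_space \<times> 'a \<Rightarrow> real) \<Rightarrow> ('a \<Rightarrow> real) \<Rightarrow> bool" where
  "lifted_lagrangian_finite L \<Phi> \<longleftrightarrow>
    (\<forall>X\<in>L2_Omega. \<forall>V\<in>L2_Omega.
       integrable (lebesgue_on Omega) (\<lambda>w. L (X w, V w)) \<and>
       integrable (lebesgue_on Omega \<Otimes>\<^sub>M lebesgue_on Omega) (\<lambda>(w, w'). \<Phi> (X w - X w')))"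

section \<open>The mean field game system\<close>

definition mfg_system ::
    "real \<Rightarrow> ('a::euclidean_space \<times> 'a \<Rightarrow> real) \<Rightarrow> ('a \<Rightarrow> real) \<Rightarrow> ('a \<Rightarrow> real) \<Rightarrow> (real \<Rightarrow> 'a) \<Rightarrow>
     (real \<Rightarrow> 'a \<Rightarrow> real) \<Rightarrow> (real \<Rightarrow> real \<Rightarrow> 'a) \<Rightarrow> bool" where
  "mfg_system T H \<Phi> \<Psi> Xs u X \<longleftrightarrow>
    (\<forall>t\<in>{0<..<T}. \<forall>q.
       integrable (lebesgue_on Omega) (\<lambda>w. \<Phi> (q - X t w)) \<and>
       deriv (\<lambda>s. u s q) t + H (q, grad (u t) q)
         - (\<integral>w. \<Phi> (q - X t w) \<partial>lebesgue_on Omega) = 0) \<and>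
    (\<forall>t\<in>{0<..<T}. \<forall>w\<in>Omega.
       vector_derivative (\<lambda>s. X s w) (at t)
         = grad (\<lambda>p. H (X t w, p)) (grad (u t) (X t w))) \<and>
    (\<forall>q. integrable (lebesgue_on Omega) (\<lambda>w. \<Psi> (q - X 0 w)) \<and>
         u 0 q = (\<integral>w. \<Psi> (q - X 0 w) \<partial>lebesgue_on Omega)) \<and>
    (\<forall>w\<in>Omega. X T w = Xs w)"

section \<open>The game\<close>

text \<open>The Lebesgue integral with values in \<open>[-\<infinity>, \<infinity>]\<close>. It is only applied to functions that are bounded
  below on a finite measure space, where the value \<open>\<infinity>\<close> stands for an infinite cost. The Bochner
  integral would give such a function the value 0.\<close>

definition ereal_integral :: "'b measure \<Rightarrow> ('b \<Rightarrow> ereal) \<Rightarrow> ereal" where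
  "ereal_integral M f =
     enn2ereal (\<integral>\<^sup>+ x. e2ennreal (f x) \<partial>M) - enn2ereal (\<integral>\<^sup>+ x. e2ennreal (- f x) \<partial>M)"

definition collective_control :: "real \<Rightarrow> (real \<Rightarrow> real \<Rightarrow> 'a::euclidean_space) \<Rightarrow> bool" where
  "collective_control T \<alpha> \<longleftrightarrow>
    (\<lambda>(t, w). \<alpha> t w) \<in> borel_measurable (lebesgue_on ({0..T} \<times> Omega)) \<and>
    (\<forall>w\<in>Omega. integrable (lebesgue_on {0..T}) (\<lambda>t. \<alpha> t w))"

text \<open>For integrable \<open>\<alpha>(\<cdot>, w)\<close> this is the absolutely continuous solution of \<open>X' = \<alpha>\<close> (almost
  everywhere) with \<open>X(T, w) = Xs w\<close>.\<close>

definition trajectory ::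
    "real \<Rightarrow> (real \<Rightarrow> 'a::euclidean_space) \<Rightarrow> (real \<Rightarrow> real \<Rightarrow> 'a) \<Rightarrow> real \<Rightarrow> real \<Rightarrow> 'a" where
  "trajectory T Xs \<alpha> t w = Xs w - (\<integral>s. \<alpha> s w \<partial>lebesgue_on {t..T})"

definition deviation ::
    "(real \<Rightarrow> 'a) \<Rightarrow> (real \<Rightarrow> real \<Rightarrow> 'a) \<Rightarrow> real \<Rightarrow> (real \<Rightarrow> 'a) \<Rightarrow> real \<Rightarrow> real \<Rightarrow> 'a" where
  "deviation Xs \<alpha> w0 A t w = (if Xs w = Xs w0 then A t else \<alpha> t w)"

text \<open>The cost of the player \<open>q = Xs w0\<close> when the collective control \<open>\<beta>\<close> is played. The control of that
  player is \<open>\<beta>(\<cdot>, w0)\<close> and need not be a separate argument. A measurable but non-integrable control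
  has cost \<open>\<infinity>\<close>, because \<open>L(q, v)\<close> grows at least quadratically in \<open>v\<close>; the value of
  \<open>trajectory\<close> is immaterial then. The last term is evaluated at the
  player's final position \<open>q\<close>, not at the initial position of the player's trajectory.\<close>

definition player_cost ::
    "('a::euclidean_space \<times> 'a \<Rightarrow> real) \<Rightarrow> ('a \<Rightarrow> real) \<Rightarrow> ('a \<Rightarrow> real) \<Rightarrow> real \<Rightarrow> (real \<Rightarrow> 'a) \<Rightarrow>
     real \<Rightarrow> (real \<Rightarrow> real \<Rightarrow> 'a) \<Rightarrow> ereal" where
  "player_cost L \<Phi> \<Psi> T Xs w0 \<beta> =
     ereal_integral (lebesgue_on {0..T})
       (\<lambda>t. ereal (L (trajectory T Xs \<beta> t w0, \<beta> t w0)))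
   + ereal_integral (lebesgue_on {0..T})
       (\<lambda>t. ereal_integral (lebesgue_on Omega)
          (\<lambda>w. ereal (\<Phi> (trajectory T Xs \<beta> t w0 - trajectory T Xs \<beta> t w))))
   + ereal_integral (lebesgue_on Omega)
       (\<lambda>w. ereal (\<Psi> (Xs w0 - trajectory T Xs \<beta> 0 w)))"

text \<open>In equilibrium the costs are real numbers. Without this, a collective control so wild that the
  interaction term is \<open>\<infinity>\<close> whatever a single player does would count as an equilibrium.\<close>

definition nash_equilibrium ::
    "('a::euclidean_space \<times> 'a \<Rightarrow> real) \<Rightarrow> ('a \<Rightarrow> real) \<Rightarrow> ('a \<Rightarrow> real) \<Rightarrow> real \<Rightarrow> (real \<Rightarrow> 'a) \<Rightarrow>
     (real \<Rightarrow> real \<Rightarrow> 'a) \<Rightarrow> bool" where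
  "nash_equilibrium L \<Phi> \<Psi> T Xs \<alpha> \<longleftrightarrow>
    collective_control T \<alpha> \<and>
    (\<forall>w0\<in>Omega.
       \<bar>player_cost L \<Phi> \<Psi> T Xs w0 \<alpha>\<bar> \<noteq> \<infinity> \<and>
       (\<forall>A\<in>borel_measurable (lebesgue_on {0..T}).
          player_cost L \<Phi> \<Psi> T Xs w0 \<alpha> \<le> player_cost L \<Phi> \<Psi> T Xs w0 (deviation Xs \<alpha> w0 A)))"

end

theory Submission
  imports Defs
begin

text \<open>The terminal term of the cost is evaluated at the prescribed final position, and a single player
  is negligible because \<open>Xs\<close> is non-atomic. Hence a player can influence only
  \<open>\<integral> L(Y, Y') + V(t, Y) dt\<close>, where \<open>Y(T) = q\<close> and \<open>V(t, x) = \<integral> \<Phi>(x - Z(t, w)) dw\<close> is given by the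
  flow \<open>Z\<close> of all players. In particular an equilibrium is in general not the flow \<open>X\<close> of the mean
  field system, whose value function starts from \<open>\<Psi>\<close>.

  The smallness of \<open>T\<close> makes the reduced cost strongly convex in the control, with modulus
  \<open>\<mu> = \<lambda> - c\<^sup>- T\<^sup>2 > 0\<close>: the kinetic convexity beats the concavity of \<open>V\<close>, since
  \<open>|Y\<^sub>1 - Y\<^sub>2|\<^sup>2 \<le> T \<integral> |Y\<^sub>1' - Y\<^sub>2'|\<^sup>2\<close> if \<open>Y\<^sub>1(T) = Y\<^sub>2(T)\<close>. Therefore each player has
  a unique best response to \<open>Z\<close>. If two flows differ by at most \<open>S\<close>, the difference of their potentials
  has Lipschitz constant \<open>\<parallel>\<nabla>\<^sup>2\<Phi>\<parallel> S\<close>, and adding the two strong convexity inequalities shows that the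
  best responses differ by at most \<open>2 \<parallel>\<nabla>\<^sup>2\<Phi>\<parallel> T\<^sup>2 S / \<mu>\<close>. The factor is less than 1 by the smallness
  condition. Banach's theorem gives existence. For uniqueness one needs in addition that two
  equilibrium flows are at bounded distance, which holds because both potentials are Lipschitz.\<close>

section \<open>Consequences of the conditions on the data\<close>

text \<open>Strong convexity is kept only in midpoint form. It replaces weak compactness, because
  minimizing sequences become Cauchy in L^1, and it replaces first variations, because the midpoint
  of two controls competes with both. The obstacle is measurability. Minimizers are chosen
  separately for each final position q, so nothing is known about a control as a function of q at a
  fixed time; what depends continuously on q is the path. The fixed point is therefore sought among
  continuous position fields y(t, q), which can be composed with a merely measurable
  \<open>Xs\<close>, and a jointly measurable control is reconstructed afterwards. Position fields
  are unbounded in q; the complete metric space consists of the bounded continuous perturbations of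
  one best response. Conversely, an arbitrary equilibrium is measurable only for the completed
  Lebesgue measure on the product, whereas the averages over labels need trajectories measurable for
  the product of the two sigma-algebras. This is gained from their continuity in time.\<close>

lemma Ck_on_SucD:
  assumes "Ck_on (Suc k) f UNIV"
  shows "f differentiable (at x)" and "Ck_on k (\<lambda>x. frechet_derivative f (at x) h) UNIV"
proof -
  obtain f' where f': "\<And>x. (f has_derivative f' x) (at x)" "\<And>h. Ck_on k (\<lambda>x. f' x h) UNIV"
    using assms by auto
  then have "frechet_derivative f (at x) = f' x" for x
    by (metis frechet_derivative_at)
  with f' show "f differentiable (at x)" and "Ck_on k (\<lambda>x. frechet_derivative f (at x) h) UNIV"
    by (auto simp: differentiable_def)
qed

text \<open>\<open>grad\<close> is a definite description, so a witness is needed first. In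
  coordinates it also reduces differentiability of the gradient to that of the directional
  derivatives supplied by \<open>Ck_on\<close>.\<close>

lemma has_derivative_grad_sum:
  fixes f :: "'a::euclidean_space \<Rightarrow> real"
  assumes "f differentiable (at x)"
  shows "GDERIV f x :> (\<Sum>b\<in>Basis. frechet_derivative f (at x) b *\<^sub>R b)"
proof -
  have 1: "(f has_derivative frechet_derivative f (at x)) (at x)"
    using assms frechet_derivative_works by blast
  then interpret bounded_linear "frechet_derivative f (at x)"
    by (rule has_derivative_bounded_linear)
  have "frechet_derivative f (at x) h = inner h (\<Sum>b\<in>Basis. frechet_derivative f (at x) b *\<^sub>R b)" for h
  proof -
    have "frechet_derivative f (at x) h = frechet_derivative f (at x) (\<Sum>b\<in>Basis. inner h b *\<^sub>R b)"
      by (simp add: euclidean_representation)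
    also have "\<dots> = inner h (\<Sum>b\<in>Basis. frechet_derivative f (at x) b *\<^sub>R b)"
      by (simp add: sum scale inner_sum_right mult.commute)
    finally show ?thesis .
  qed
  with 1 show ?thesis
    unfolding gderiv_def by (metis (no_types, lifting) ext)
qed

lemma grad_eq:
  assumes "GDERIV f x :> D"
  shows "grad f x = D"
proof -
  have "D' = D" if "GDERIV f x :> D'" for D'
  proof -
    have "(\<lambda>h. inner h D') = (\<lambda>h. inner h D)"
      using that assms unfolding gderiv_def by (rule has_derivative_unique)
    then have "inner h D' = inner h D" for h
      by metis
    then show ?thesis
      by (metis vector_eq_ldot)
  qed
  then show ?thesis
    unfolding grad_def by (rule the_equality[where P = "\<lambda>D. GDERIV f x :> D", OF assms])
qed

lemma frechet_derivative_grad: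
  fixes f :: "'a::euclidean_space \<Rightarrow> real"
  assumes "f differentiable (at x)"
  shows "frechet_derivative f (at x) h = inner h (grad f x)"
  using has_derivative_grad_sum[OF assms] grad_eq[OF has_derivative_grad_sum[OF assms]]
  by (metis frechet_derivative_at gderiv_def)

lemma has_derivative_grad:
  fixes f :: "'a::euclidean_space \<Rightarrow> real"
  assumes "f differentiable (at x)"
  shows "(f has_derivative (\<lambda>h. inner h (grad f x))) (at x)"
  using has_derivative_grad_sum[OF assms] grad_eq[OF has_derivative_grad_sum[OF assms]]
  by (simp add: gderiv_def)

lemma has_derivative_hess:
  fixes f :: "'a::euclidean_space \<Rightarrow> real"
  assumes "Ck_on (Suc (Suc k)) f UNIV"
  shows "(grad f has_derivative hess f x) (at x)"
proof -
  have eq: "grad f = (\<lambda>x. \<Sum>b\<in>Basis. frechet_derivative f (at x) b *\<^sub>R b)"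
    using grad_eq[OF has_derivative_grad_sum[OF Ck_on_SucD(1)[OF assms]]] by auto
  have "grad f differentiable (at x)"
    unfolding eq
    by (intro differentiable_sum ballI differentiable_scaleR Ck_on_SucD(1)[OF Ck_on_SucD(2)[OF assms]]) auto
  then show ?thesis
    unfolding hess_def using frechet_derivative_works by blast
qed

text \<open>The supremum in \<open>hess_Linf\<close> is meaningful only once its range is bounded
  above. Testing the second derivative with the pair g = \<open>hess f x h\<close> and h gives |g|^2
  \<le> C |g| |h|, which is a bound on the operator norm.\<close>

lemma onorm_hess_le:
  fixes f :: "'a::euclidean_space \<Rightarrow> real"
  assumes f: "Ck_on (Suc (Suc k)) f UNIV" and bdd: "bounded_kth_derivative 2 f"
  shows "onorm (hess f x) \<le> hess_Linf f"
proof -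
  obtain C where C: "\<And>hs x. length hs = 2 \<Longrightarrow> \<bar>iter_deriv hs f x\<bar> \<le> C * prod_list (map norm hs)"
    using bdd unfolding bounded_kth_derivative_def by blast
  have "onorm (hess f x) \<le> max C 0" for x
  proof (rule onorm_le)
    fix h :: 'a
    let ?g = "hess f x h"
    have eq: "(\<lambda>x. frechet_derivative f (at x) ?g) = (\<lambda>x. inner ?g (grad f x))"
      using frechet_derivative_grad[OF Ck_on_SucD(1)[OF f]] by auto
    have "((\<lambda>x. inner ?g (grad f x)) has_derivative (\<lambda>h'. inner ?g (hess f x h'))) (at x)"
      by (intro has_derivative_inner_right has_derivative_hess[OF f])
    then have "iter_deriv [?g, h] f x = inner ?g ?g"
      using frechet_derivative_at eq by (metis iter_deriv.simps)
    then have "(norm ?g)\<^sup>2 \<le> C * (norm ?g * norm h)"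
      using C[of "[?g, h]" x] by (simp add: power2_norm_eq_inner)
    then have "norm ?g * norm ?g \<le> norm ?g * (C * norm h)"
      by (simp add: power2_eq_square algebra_simps)
    then have "norm ?g \<le> C * norm h \<or> norm ?g = 0"
      by (metis mult_le_cancel_left_pos norm_ge_zero order_le_less)
    moreover have "C * norm h \<le> max C 0 * norm h"
      by (intro mult_right_mono) auto
    ultimately show "norm ?g \<le> max C 0 * norm h"
      by (auto simp: zero_le_mult_iff)
  qed
  then have "bdd_above (range (\<lambda>x. onorm (hess f x)))"
    by (intro bdd_aboveI) auto
  then show ?thesis
    unfolding hess_Linf_def by (intro cSUP_upper) auto
qed

section \<open>Lipschitz and second difference bounds\<close>

lemma lipschitz_if_bounded_derivative:
  fixes f :: "'a::euclidean_space \<Rightarrow> 'b::real_normed_vector"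
  assumes "\<And>x. (f has_derivative f' x) (at x)" and "\<And>x. onorm (f' x) \<le> C"
  shows "norm (f x - f y) \<le> C * norm (x - y)"
  using differentiable_bound[of UNIV f f' C] assms by auto

lemma potential_lipschitz:
  assumes "Ck_on (Suc k) f UNIV" and "bounded_kth_derivative 1 f"
  obtains B where "B \<ge> 0" "\<And>x y. \<bar>f x - f y\<bar> \<le> B * norm (x - y)"
proof -
  obtain C where C: "\<And>hs x. length hs = 1 \<Longrightarrow> \<bar>iter_deriv hs f x\<bar> \<le> C * prod_list (map norm hs)"
    using assms(2) unfolding bounded_kth_derivative_def by blast
  have "onorm (frechet_derivative f (at x)) \<le> max C 0" for x
  proof (rule onorm_le)
    fix h
    have "\<bar>frechet_derivative f (at x) h\<bar> \<le> C * norm h"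
      using C[of "[h]" x] by simp
    also have "\<dots> \<le> max C 0 * norm h"
      by (intro mult_right_mono) auto
    finally show "norm (frechet_derivative f (at x) h) \<le> max C 0 * norm h"
      by simp
  qed
  then have "\<bar>f x - f y\<bar> \<le> max C 0 * norm (x - y)" for x y
    using lipschitz_if_bounded_derivative[of f "\<lambda>x. frechet_derivative f (at x)" "max C 0" x y]
      Ck_on_SucD(1)[OF assms(1)] frechet_derivative_works by force
  then show ?thesis
    using that[of "max C 0"] by auto
qed

text \<open>The map x \<mapsto> f(x - a) - f(x - b) has gradient at most
  \<open>hess_Linf f * norm (a - b)\<close>, because \<open>grad f\<close> is Lipschitz. With a and
  b the positions of one player in two flows, this bounds the change of the force by the
  displacement.\<close>

lemma potential_second_difference:
  fixes f :: "'a::euclidean_space \<Rightarrow> real"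
  assumes f: "Ck_on (Suc (Suc k)) f UNIV" and bdd: "bounded_kth_derivative 2 f"
  shows "\<bar>(f (x - a) - f (x - b)) - (f (y - a) - f (y - b))\<bar>
           \<le> hess_Linf f * norm (a - b) * norm (x - y)"
proof -
  have lip: "norm (grad f x - grad f y) \<le> hess_Linf f * norm (x - y)" for x y
    using lipschitz_if_bounded_derivative has_derivative_hess[OF f] onorm_hess_le[OF f bdd] by blast
  have d: "((\<lambda>x. f (x - a) - f (x - b)) has_derivative
      (\<lambda>h. inner h (grad f (x - a)) - inner h (grad f (x - b)))) (at x)" for x
  proof -
    have "((\<lambda>x. f (x - a)) has_derivative (\<lambda>h. inner h (grad f (x - a)))) (at x)" for a
    proof -
      have "((\<lambda>x. x - a) has_derivative (\<lambda>h. h)) (at x)"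
        by (auto intro!: derivative_eq_intros)
      from has_derivative_compose[OF this has_derivative_grad[OF Ck_on_SucD(1)[OF f]]]
      show ?thesis .
    qed
    then show ?thesis
      by (rule has_derivative_diff) fact
  qed
  have "onorm (\<lambda>h. inner h (grad f (x - a)) - inner h (grad f (x - b))) \<le> hess_Linf f * norm (a - b)" for x
  proof (rule onorm_le)
    fix h
    have "norm (inner h (grad f (x - a)) - inner h (grad f (x - b))) \<le> norm h * norm (grad f (x - a) - grad f (x - b))"
      by (simp add: inner_diff_right[symmetric] Cauchy_Schwarz_ineq2)
    also have "\<dots> \<le> norm h * (hess_Linf f * norm (a - b))"
      using lip[of "x - a" "x - b"] by (intro mult_left_mono) (auto simp: norm_minus_commute)
    finally show "norm (inner h (grad f (x - a)) - inner h (grad f (x - b))) \<le> hess_Linf f * norm (a - b) * norm h"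
      by (simp add: mult.commute)
  qed
  from lipschitz_if_bounded_derivative[OF d this] show ?thesis
    by simp
qed

text \<open>Subtracting the parabola c s^2 / 2 leaves a convex function, and the midpoint defect of
  the parabola is c/4. A negative c is allowed, so the lemma serves both the Lagrangian and the
  possibly concave potential.\<close>

lemma midpoint_strong_convexity:
  fixes \<phi> :: "real \<Rightarrow> real"
  assumes 1: "\<And>s. s \<in> {0..1} \<Longrightarrow> (\<phi> has_real_derivative \<phi>' s) (at s)"
    and 2: "\<And>s. s \<in> {0..1} \<Longrightarrow> (\<phi>' has_real_derivative \<phi>'' s) (at s)"
    and 3: "\<And>s. s \<in> {0..1} \<Longrightarrow> c \<le> \<phi>'' s"
  shows "2 * \<phi> (1/2) \<le> \<phi> 0 + \<phi> 1 - c / 4"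
proof -
  have "convex_on {0..1} (\<lambda>s. \<phi> s - c / 2 * s\<^sup>2)"
  proof (rule f''_ge0_imp_convex[where f' = "\<lambda>s. \<phi>' s - c * s" and f'' = "\<lambda>s. \<phi>'' s - c"])
    fix s :: real assume s: "s \<in> {0..1}"
    show "((\<lambda>s. \<phi> s - c / 2 * s\<^sup>2) has_real_derivative \<phi>' s - c * s) (at s)"
      by (rule derivative_eq_intros 1[OF s] | simp)+
    show "((\<lambda>s. \<phi>' s - c * s) has_real_derivative \<phi>'' s - c) (at s)"
      by (rule derivative_eq_intros 2[OF s] | simp)+
  qed (use 3 in auto)
  from convex_onD[OF this, of "1/2" 0 1] show ?thesis
    by (simp add: power2_eq_square field_simps)
qed

lemma add_half_diff: "x + (1/2) *\<^sub>R (y - x) = (1/2) *\<^sub>R (x + y)" for x y :: "'a::real_vector"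
proof -
  have "x = (1/2) *\<^sub>R x + (1/2) *\<^sub>R x"
    by (simp flip: scaleR_left_distrib)
  then show ?thesis
    by (simp add: algebra_simps)
qed

lemma potential_midpoint:
  fixes f :: "'a::euclidean_space \<Rightarrow> real"
  assumes f: "Ck_on (Suc (Suc k)) f UNIV" and c: "\<And>x h. c * (norm h)\<^sup>2 \<le> inner (hess f x h) h"
  shows "2 * f ((1/2) *\<^sub>R (x + y)) \<le> f x + f y + negpart c / 4 * (norm (x - y))\<^sup>2"
proof -
  define h where "h = y - x"
  have l: "((\<lambda>s. x + s *\<^sub>R h) has_derivative (\<lambda>d. d *\<^sub>R h)) (at s)" for s
    by (rule derivative_eq_intros refl | simp)+
  have 1: "((\<lambda>s. f (x + s *\<^sub>R h)) has_real_derivative inner h (grad f (x + s *\<^sub>R h))) (at s)" for s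
    using has_derivative_compose[OF l has_derivative_grad[OF Ck_on_SucD(1)[OF f]]]
    by (simp add: has_field_derivative_def mult_commute_abs)
  have 2: "((\<lambda>s. inner h (grad f (x + s *\<^sub>R h))) has_real_derivative inner h (hess f (x + s *\<^sub>R h) h)) (at s)" for s
  proof -
    interpret bounded_linear "hess f (x + s *\<^sub>R h)"
      using has_derivative_hess[OF f] has_derivative_bounded_linear by blast
    show ?thesis
      using has_derivative_inner_right[OF has_derivative_compose[OF l has_derivative_hess[OF f]], of h s]
      by (simp add: has_field_derivative_def scale mult_commute_abs)
  qed
  have "2 * f (x + (1/2) *\<^sub>R h) \<le> f (x + 0 *\<^sub>R h) + f (x + 1 *\<^sub>R h) - c * (norm h)\<^sup>2 / 4"
    using 1 2 c by (intro midpoint_strong_convexity) (auto simp: inner_commute)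
  moreover have "x + (1/2) *\<^sub>R h = (1/2) *\<^sub>R (x + y)"
    unfolding h_def by (rule add_half_diff)
  moreover have "- c * (norm h)\<^sup>2 \<le> negpart c * (norm h)\<^sup>2"
    by (intro mult_right_mono) auto
  ultimately show ?thesis
    by (simp add: h_def norm_minus_commute)
qed

lemma lagrangian_midpoint:
  assumes L: "Ck_on (Suc (Suc k)) L UNIV" and c: "lagrangian_conditions L c0 c1 lam"
  shows "2 * L ((1/2) *\<^sub>R (z + z')) \<le> L z + L z' - lam / 4 * (norm (snd z - snd z'))\<^sup>2"
proof -
  define h where "h = z' - z"
  have l: "((\<lambda>s. z + s *\<^sub>R h) has_derivative (\<lambda>d. d *\<^sub>R h)) (at s)" for s
    by (rule derivative_eq_intros refl | simp)+
  have 1: "((\<lambda>s. L (z + s *\<^sub>R h)) has_real_derivative inner h (grad L (z + s *\<^sub>R h))) (at s)" for s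
    using has_derivative_compose[OF l has_derivative_grad[OF Ck_on_SucD(1)[OF L]]]
    by (simp add: has_field_derivative_def mult_commute_abs)
  have 2: "((\<lambda>s. inner h (grad L (z + s *\<^sub>R h))) has_real_derivative inner h (hess L (z + s *\<^sub>R h) h)) (at s)" for s
  proof -
    interpret bounded_linear "hess L (z + s *\<^sub>R h)"
      using has_derivative_hess[OF L] has_derivative_bounded_linear by blast
    show ?thesis
      using has_derivative_inner_right[OF has_derivative_compose[OF l has_derivative_hess[OF L]], of h s]
      by (simp add: has_field_derivative_def scale mult_commute_abs)
  qed
  \<comment> \<open>The convexity hypothesis is stated with iterated \<open>deriv\<close>, which
    says something only where derivatives exist; differentiability of L and its gradient identifies
    it with the Hessian form.\<close>
  have "deriv (\<lambda>s. L (z + s *\<^sub>R h)) = (\<lambda>s. inner h (grad L (z + s *\<^sub>R h)))"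
    using 1 DERIV_imp_deriv by blast
  then have d2: "(deriv ^^ 2) (\<lambda>s. L (z + s *\<^sub>R h)) s = inner h (hess L (z + s *\<^sub>R h) h)" for s
    using 2 DERIV_imp_deriv by (simp add: numeral_2_eq_2) blast
  have eq: "(\<lambda>s. L (z + s *\<^sub>R h)) = (\<lambda>s. L ((1 - s) *\<^sub>R fst z + s *\<^sub>R fst z', (1 - s) *\<^sub>R snd z + s *\<^sub>R snd z'))"
    by (rule ext, rule arg_cong[where f = L]) (auto simp: h_def prod_eq_iff algebra_simps)
  have "lam * (norm (snd z' - snd z))\<^sup>2 \<le> inner h (hess L (z + s *\<^sub>R h) h)" if "s \<in> {0..1}" for s
    unfolding d2[symmetric] eq using c that unfolding lagrangian_conditions_def by blast
  then have "2 * L (z + (1/2) *\<^sub>R h) \<le> L (z + 0 *\<^sub>R h) + L (z + 1 *\<^sub>R h) - lam * (norm (snd z' - snd z))\<^sup>2 / 4"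
    using 1 2 by (intro midpoint_strong_convexity) auto
  moreover have "z + (1/2) *\<^sub>R h = (1/2) *\<^sub>R (z + z')"
    unfolding h_def by (rule add_half_diff)
  ultimately show ?thesis
    by (simp add: h_def norm_minus_commute)
qed

lemma lagrangian_lipschitz:
  assumes L: "Ck_on (Suc k) L UNIV" and c: "lagrangian_conditions L c0 c1 lam"
  shows "\<bar>L (x, v) - L (y, v)\<bar> \<le> c1 * norm (x - y)"
proof -
  have "(\<lambda>y. L (y, v)) differentiable (at x)" for x
  proof (rule differentiable_compose[of L "\<lambda>y. (y, v)"])
    show "L differentiable (at (x, v))"
      using Ck_on_SucD(1)[OF L] .
    show "(\<lambda>y. (y, v)) differentiable (at x)"
      unfolding differentiable_def by (auto intro!: derivative_eq_intros)
  qed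
  then have d: "((\<lambda>y. L (y, v)) has_derivative (\<lambda>h. inner h (grad (\<lambda>y. L (y, v)) x))) (at x)" for x
    by (rule has_derivative_grad)
  have "onorm (\<lambda>h. inner h (grad (\<lambda>y. L (y, v)) x)) \<le> c1" for x
  proof (rule onorm_le)
    fix h
    have "norm (inner h (grad (\<lambda>y. L (y, v)) x)) \<le> norm h * norm (grad (\<lambda>y. L (y, v)) x)"
      by (simp add: Cauchy_Schwarz_ineq2)
    also have "\<dots> \<le> norm h * c1"
      using c unfolding lagrangian_conditions_def by (intro mult_left_mono) auto
    finally show "norm (inner h (grad (\<lambda>y. L (y, v)) x)) \<le> c1 * norm h"
      by (simp add: mult.commute)
  qed
  from lipschitz_if_bounded_derivative[OF d this, of x y] show ?thesis
    by simp
qed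

section \<open>Paths with prescribed end point\<close>

text \<open>Cauchy-Schwarz against the constant 1, from the nonnegativity of the integral of (m |f|
  - S)^2. This yields m times the claim, so a space of measure zero is treated separately.\<close>

lemma (in finite_measure) square_integral_norm_le:
  fixes f :: "'a \<Rightarrow> 'b::{second_countable_topology, banach}"
  assumes [measurable]: "f \<in> borel_measurable M" and sq: "integrable M (\<lambda>x. (norm (f x))\<^sup>2)"
  shows "integrable M f" and "(\<integral>x. norm (f x) \<partial>M)\<^sup>2 \<le> measure M (space M) * (\<integral>x. (norm (f x))\<^sup>2 \<partial>M)"
proof -
  show int: "integrable M f"
    using square_integrable_imp_integrable[of "\<lambda>x. norm (f x)"] sq by (simp add: integrable_norm_iff)
  define S where "S = (\<integral>x. norm (f x) \<partial>M)"
  define m where "m = measure M (space M)"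
  have "0 \<le> (\<integral>x. (m * norm (f x) - S)\<^sup>2 \<partial>M)"
    by simp
  also have "(\<integral>x. (m * norm (f x) - S)\<^sup>2 \<partial>M)
      = (\<integral>x. m\<^sup>2 * (norm (f x))\<^sup>2 - 2 * m * S * norm (f x) + S\<^sup>2 \<partial>M)"
    by (intro Bochner_Integration.integral_cong refl) (simp add: power2_eq_square algebra_simps)
  also have "\<dots> = m\<^sup>2 * (\<integral>x. (norm (f x))\<^sup>2 \<partial>M) - 2 * m * S * S + m * S\<^sup>2"
    using int sq by (simp add: S_def m_def)
  finally have *: "m * S\<^sup>2 \<le> m * (m * (\<integral>x. (norm (f x))\<^sup>2 \<partial>M))"
    by (simp add: power2_eq_square algebra_simps)
  have "S\<^sup>2 \<le> m * (\<integral>x. (norm (f x))\<^sup>2 \<partial>M)"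
  proof (cases "m = 0")
    case True
    then have "emeasure M (space M) = 0"
      by (simp add: m_def emeasure_eq_measure)
    then have "AE x in M. norm (f x) = 0"
      by (intro AE_I[of _ _ "space M"]) auto
    then have "S = 0"
      unfolding S_def by (rule integral_eq_zero_AE)
    with True show ?thesis by simp
  next
    case False
    then have "m > 0" by (simp add: m_def less_le)
    with * show ?thesis by simp
  qed
  then show "(\<integral>x. norm (f x) \<partial>M)\<^sup>2 \<le> measure M (space M) * (\<integral>x. (norm (f x))\<^sup>2 \<partial>M)"
    by (simp add: S_def m_def)
qed

text \<open>Summable L^1 increments make the pointwise increments summable almost everywhere, so the
  sequence itself converges, not just a subsequence. Writing the limit as \<open>lim\<close> defines
  it everywhere and keeps it measurable, also jointly in a parameter.\<close>

lemma fast_L1_Cauchy_limit: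
  fixes f :: "nat \<Rightarrow> 'a \<Rightarrow> 'b::{banach, second_countable_topology}"
  assumes int: "\<And>n. integrable M (f n)"
    and summ: "summable (\<lambda>n. \<integral>x. norm (f (Suc n) x - f n x) \<partial>M)"
  shows "AE x in M. (\<lambda>n. f n x) \<longlonglongrightarrow> lim (\<lambda>n. f n x)"
    and "integrable M (\<lambda>x. lim (\<lambda>n. f n x))"
    and "(\<lambda>n. \<integral>x. norm (f n x - lim (\<lambda>n. f n x)) \<partial>M) \<longlonglongrightarrow> 0"
proof -
  note [measurable] = borel_measurable_integrable[OF int]
  define g where "g n x = norm (f (Suc n) x - f n x)" for n x
  define F where "F x = lim (\<lambda>n. f n x)" for x
  have [measurable]: "g n \<in> borel_measurable M" "F \<in> borel_measurable M" for n
    unfolding g_def F_def by measurable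
  have g: "integrable M (g n)" for n
    unfolding g_def using int by auto
  have g0: "g n x \<ge> 0" for n x
    by (simp add: g_def)
  have "(\<integral>\<^sup>+x. (\<Sum>n. ennreal (g n x)) \<partial>M) = (\<Sum>n. \<integral>\<^sup>+x. ennreal (g n x) \<partial>M)"
    by (intro nn_integral_suminf) measurable
  also have "\<dots> = (\<Sum>n. ennreal (\<integral>x. g n x \<partial>M))"
    using g g0 by (simp add: nn_integral_eq_integral)
  also have "\<dots> < \<infinity>"
    using summ g0 unfolding g_def[symmetric] by (simp add: suminf_ennreal2 less_top)
  finally have "AE x in M. (\<Sum>n. ennreal (g n x)) \<noteq> \<infinity>"
    by (intro nn_integral_PInf_AE) auto
  then have summ_AE: "AE x in M. summable (\<lambda>n. g n x)"
    by eventually_elim (metis g0 infinity_ennreal_def summable_suminf_not_top)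
  \<comment> \<open>By telescoping, \<open>w\<close> dominates every \<open>f n\<close> and hence
    the limit.\<close>
  define w where "w x = norm (f 0 x) + (\<Sum>n. g n x)" for x
  have w: "integrable M w"
    unfolding w_def using g summ_AE summ int g0
    by (intro Bochner_Integration.integrable_add integrable_suminf integrable_norm)
      (auto simp: g_def[symmetric])
  have tele: "f n x = f 0 x + (\<Sum>i<n. f (Suc i) x - f i x)" for n x
    using sum_lessThan_telescope[of "\<lambda>i. f i x" n] by simp
  have conv: "AE x in M. (\<lambda>n. f n x) \<longlonglongrightarrow> F x"
    using summ_AE
  proof eventually_elim
    case (elim x)
    then have "summable (\<lambda>n. f (Suc n) x - f n x)"
      unfolding g_def by (rule summable_norm_cancel)
    then have "convergent (\<lambda>n. f n x)"
      unfolding summable_iff_convergent by (subst tele) (rule convergent_add[OF convergent_const])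
    then show ?case
      unfolding F_def by (rule convergent_LIMSEQ_iff[THEN iffD1])
  qed
  have bnd: "AE x in M. \<forall>n. norm (f n x) \<le> w x"
    using summ_AE
  proof eventually_elim
    case (elim x)
    show ?case
    proof
      fix n
      have "norm (f n x) \<le> norm (f 0 x) + norm (\<Sum>i<n. f (Suc i) x - f i x)"
        by (subst tele) (rule norm_triangle_ineq)
      also have "norm (\<Sum>i<n. f (Suc i) x - f i x) \<le> (\<Sum>i<n. g i x)"
        unfolding g_def by (rule norm_sum)
      also have "\<dots> \<le> (\<Sum>n. g n x)"
        using elim g0 by (intro sum_le_suminf) auto
      finally show "norm (f n x) \<le> w x"
        by (simp add: w_def)
    qed
  qed
  have Fbnd: "AE x in M. norm (F x) \<le> w x"
    using conv bnd
  proof eventually_elim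
    case (elim x)
    then show ?case
      by (intro Lim_bounded[OF tendsto_norm]) auto
  qed
  show "AE x in M. (\<lambda>n. f n x) \<longlonglongrightarrow> lim (\<lambda>n. f n x)"
    using conv by (simp add: F_def)
  show "integrable M (\<lambda>x. lim (\<lambda>n. f n x))"
    unfolding F_def[symmetric] using Fbnd by (intro Bochner_Integration.integrable_bound[OF w]) auto
  have "(\<lambda>n. \<integral>x. norm (f n x - F x) \<partial>M) \<longlonglongrightarrow> (\<integral>x. 0 \<partial>M)"
  proof (rule integral_dominated_convergence[where w = "\<lambda>x. 2 * w x"])
    show "AE x in M. (\<lambda>n. norm (f n x - F x)) \<longlonglongrightarrow> 0"
      using conv by eventually_elim (simp add: LIM_zero tendsto_norm_zero)
    show "AE x in M. norm (norm (f n x - F x)) \<le> 2 * w x" for n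
      using bnd Fbnd
    proof eventually_elim
      case (elim x)
      have "norm (f n x - F x) \<le> norm (f n x) + norm (F x)"
        by (rule norm_triangle_ineq4)
      with elim show ?case
        by (metis abs_norm_cancel add_mono mult_2 order_trans real_norm_def)
    qed
  qed (use w in auto)
  then show "(\<lambda>n. \<integral>x. norm (f n x - lim (\<lambda>n. f n x)) \<partial>M) \<longlonglongrightarrow> 0"
    by (simp add: F_def)
qed

text \<open>Integration over \<open>{t..T}\<close>, not the interval integral, so that this is literally
  \<^const>\<open>trajectory\<close> for a single label.\<close>

definition terminal_path :: "real \<Rightarrow> 'a::euclidean_space \<Rightarrow> (real \<Rightarrow> 'a) \<Rightarrow> real \<Rightarrow> 'a" where
  "terminal_path T q A t = q - (\<integral>s. A s \<partial>lebesgue_on {t..T})"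

lemma finite_measure_lebesgue_on_Icc: "finite_measure (lebesgue_on {a..b::real})"
  by (metis cbox_interval finite_measure_lebesgue_on lmeasurable_cbox)

lemma measure_lebesgue_on_Icc: "a \<le> b \<Longrightarrow> measure (lebesgue_on {a..b::real}) {a..b} = b - a"
  by (simp add: measure_restrict_space)

lemma path_minus_endpoint:
  assumes "integrable (lebesgue_on {0..T}) A" and "t \<in> {0..T}"
  shows "norm (terminal_path T q A t - q) \<le> (\<integral>s. norm (A s) \<partial>lebesgue_on {0..T})"
proof -
  have sub: "integrable (lebesgue_on {t..T}) A"
    using integrable_subinterval[OF assms(1)] assms(2) by auto
  have "norm (terminal_path T q A t - q) = norm (\<integral>s. A s \<partial>lebesgue_on {t..T})"
    by (simp add: terminal_path_def)
  also have "\<dots> \<le> (\<integral>s. norm (A s) \<partial>lebesgue_on {t..T})"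
    by (rule integral_norm_bound)
  also have "\<dots> \<le> (\<integral>s. norm (A s) \<partial>lebesgue_on {0..T})"
    using assms by (intro integral_mono_lebesgue_on_AE) auto
  finally show ?thesis .
qed

lemma path_diff:
  assumes A: "integrable (lebesgue_on {0..T}) A" and B: "integrable (lebesgue_on {0..T}) B" and t: "t \<in> {0..T}"
  shows "terminal_path T q A t - terminal_path T q' B t = terminal_path T (q - q') (\<lambda>s. A s - B s) t"
proof -
  have "integrable (lebesgue_on {t..T}) A" "integrable (lebesgue_on {t..T}) B"
    using integrable_subinterval[OF A, of t T] integrable_subinterval[OF B, of t T] t by auto
  then show ?thesis
    by (simp add: terminal_path_def)
qed

lemma path_midpoint:
  assumes A: "integrable (lebesgue_on {0..T}) A" and B: "integrable (lebesgue_on {0..T}) B" and t: "t \<in> {0..T}"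
  shows "terminal_path T q (\<lambda>s. (1/2) *\<^sub>R (A s + B s)) t = (1/2) *\<^sub>R (terminal_path T q A t + terminal_path T q B t)"
proof -
  have "integrable (lebesgue_on {t..T}) A" "integrable (lebesgue_on {t..T}) B"
    using integrable_subinterval[OF A, of t T] integrable_subinterval[OF B, of t T] t by auto
  moreover have "(1/2) *\<^sub>R q + (1/2) *\<^sub>R q = q"
    by (simp flip: scaleR_left_distrib)
  ultimately show ?thesis
    by (simp add: terminal_path_def algebra_simps)
qed

lemma norm_path_diff_le:
  assumes A: "integrable (lebesgue_on {0..T}) A" and B: "integrable (lebesgue_on {0..T}) B" and t: "t \<in> {0..T}"
  shows "norm (terminal_path T q A t - terminal_path T q' B t) \<le> norm (q - q') + (\<integral>s. norm (A s - B s) \<partial>lebesgue_on {0..T})"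
proof -
  have "norm (terminal_path T (q - q') (\<lambda>s. A s - B s) t - (q - q')) \<le> (\<integral>s. norm (A s - B s) \<partial>lebesgue_on {0..T})"
    using A B t by (intro path_minus_endpoint) auto
  then show ?thesis
    unfolding path_diff[OF A B t]
    using norm_triangle_sub[of "terminal_path T (q - q') (\<lambda>s. A s - B s) t" "q - q'"] by linarith
qed

lemma continuous_on_path:
  assumes A: "integrable (lebesgue_on {0..T}) A"
  shows "continuous_on {0..T} (terminal_path T q A)"
proof -
  have 1: "continuous_on {0..T} (\<lambda>t. integral {t..T} A)"
    using A by (intro indefinite_integral_continuous_1' integrable_on_lebesgue_on) auto
  have 2: "(\<integral>s. A s \<partial>lebesgue_on {t..T}) = integral {t..T} A" if "t \<in> {0..T}" for t
    using integrable_subinterval[OF A, of t T] that by (intro lebesgue_integral_eq_integral) auto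
  have "continuous_on {0..T} (\<lambda>t. q - (\<integral>s. A s \<partial>lebesgue_on {t..T}))"
    by (intro continuous_intros) (subst continuous_on_cong[OF refl 2], auto simp: 1)
  then show ?thesis
    unfolding terminal_path_def[abs_def] .
qed

lemma path_measurable:
  assumes A: "integrable (lebesgue_on {0..T}) A"
  shows "terminal_path T q A \<in> borel_measurable (lebesgue_on {0..T})"
  by (intro continuous_imp_measurable_on_sets_lebesgue continuous_on_path A) auto

section \<open>The reduced problem of a single player\<close>

text \<open>\<open>cm\<close> bounds the concavity of the potentials, \<open>B\<close> their
  Lipschitz constant and \<open>- M\<close> their values from below. Fixing these numbers here makes
  every estimate uniform over the potentials generated by different flows.\<close>

locale control_problem =
  fixes L :: "'a::euclidean_space \<times> 'a \<Rightarrow> real" and T c0 c1 lam cm B M :: real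
  assumes T_pos: "0 < T"
    and L_cont: "continuous_on UNIV L"
    and c0_pos: "0 < c0"
    and c1_nonneg: "0 \<le> c1"
    and B_nonneg: "0 \<le> B" and cm_nonneg: "0 \<le> cm" and M_nonneg: "0 \<le> M"
    and L_ge: "c0 * (norm v)\<^sup>2 \<le> L (x, v)"
    and L_lipschitz: "\<bar>L (x, v) - L (y, v)\<bar> \<le> c1 * norm (x - y)"
    and L_midpoint: "2 * L ((1/2) *\<^sub>R (x + y), (1/2) *\<^sub>R (v + w))
        \<le> L (x, v) + L (y, w) - lam / 4 * (norm (v - w))\<^sup>2"
    and cm_small: "T\<^sup>2 * cm < lam"
begin

abbreviation I :: "real measure" where "I \<equiv> lebesgue_on {0..T}"

definition mu :: real where "mu = lam - T\<^sup>2 * cm"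

text \<open>The position is frozen at 0, so this is a condition on the control alone. Since L is
  Lipschitz in the position and paths of integrable controls are bounded, it amounts to a finite
  running cost along the path to any end point.\<close>

definition admissible :: "(real \<Rightarrow> 'a) \<Rightarrow> bool" where
  "admissible A \<longleftrightarrow> A \<in> borel_measurable I \<and> integrable I (\<lambda>t. L (0, A t))"

definition potential_field :: "(real \<Rightarrow> 'a \<Rightarrow> real) \<Rightarrow> bool" where
  "potential_field V \<longleftrightarrow>
     (\<lambda>(t, x). V t x) \<in> borel_measurable (I \<Otimes>\<^sub>M borel) \<and>
     (\<forall>t x y. \<bar>V t x - V t y\<bar> \<le> B * norm (x - y)) \<and>
     (\<forall>t x. - M \<le> V t x) \<and>
     (\<forall>t x y. 2 * V t ((1/2) *\<^sub>R (x + y)) \<le> V t x + V t y + cm / 4 * (norm (x - y))\<^sup>2) \<and>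
     integrable I (\<lambda>t. V t 0)"

definition cost :: "(real \<Rightarrow> 'a \<Rightarrow> real) \<Rightarrow> 'a \<Rightarrow> (real \<Rightarrow> 'a) \<Rightarrow> real" where
  "cost V q A = (\<integral>t. L (terminal_path T q A t, A t) + V t (terminal_path T q A t) \<partial>I)"

definition minimizer :: "(real \<Rightarrow> 'a \<Rightarrow> real) \<Rightarrow> 'a \<Rightarrow> (real \<Rightarrow> 'a) \<Rightarrow> bool" where
  "minimizer V q A \<longleftrightarrow> admissible A \<and> (\<forall>A'. admissible A' \<longrightarrow> cost V q A \<le> cost V q A')"

definition energy :: "(real \<Rightarrow> 'a) \<Rightarrow> real" where
  "energy A = (\<integral>t. (norm (A t))\<^sup>2 \<partial>I)"

section \<open>Integrability of the cost along admissible controls\<close>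

lemma mu_pos: "0 < mu"
  using cm_small by (simp add: mu_def)

sublocale I: finite_measure I
  by (rule finite_measure_lebesgue_on_Icc)

lemma measure_I [simp]: "measure I {0..T} = T"
  using T_pos measure_lebesgue_on_Icc[of 0 T] by simp

lemma L_nonneg: "0 \<le> L z"
  using L_ge[of "snd z" "fst z"] c0_pos
  by (metis less_imp_le mult_nonneg_nonneg order_trans prod.collapse zero_le_power2)

lemma L_measurable [measurable]: "L \<in> borel_measurable (borel \<Otimes>\<^sub>M borel)"
  unfolding borel_prod using L_cont by (intro borel_measurable_continuous_onI)

lemma admissible_measurable: "admissible A \<Longrightarrow> A \<in> borel_measurable I"
  by (simp add: admissible_def)

lemma admissible_square_integrable:
  assumes "admissible A"
  shows "integrable I (\<lambda>t. (norm (A t))\<^sup>2)"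
proof (rule Bochner_Integration.integrable_bound)
  show "integrable I (\<lambda>t. L (0, A t) / c0)"
    using assms by (simp add: admissible_def)
  show "AE t in I. norm ((norm (A t))\<^sup>2) \<le> norm (L (0, A t) / c0)"
    using L_ge[of "A _" 0] c0_pos L_nonneg
    by (intro AE_I2) (simp add: pos_le_divide_eq mult.commute[of _ c0])
qed (use admissible_measurable[OF assms] in measurable)

lemma admissible_integrable: "admissible A \<Longrightarrow> integrable I A"
  using I.square_integral_norm_le(1)[OF admissible_measurable admissible_square_integrable] .

lemma admissible_diff_square_integrable:
  assumes "admissible A" and "admissible A'"
  shows "integrable I (\<lambda>t. (norm (A t - A' t))\<^sup>2)"
proof (rule Bochner_Integration.integrable_bound)
  show "integrable I (\<lambda>t. 2 * (norm (A t))\<^sup>2 + 2 * (norm (A' t))\<^sup>2)"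
    using assms admissible_square_integrable by simp
  have "(norm (A t - A' t))\<^sup>2 \<le> 2 * (norm (A t))\<^sup>2 + 2 * (norm (A' t))\<^sup>2" for t
  proof -
    have "(norm (A t - A' t))\<^sup>2 \<le> (norm (A t) + norm (A' t))\<^sup>2"
      by (intro power_mono norm_triangle_ineq4) auto
    also have "\<dots> \<le> 2 * (norm (A t))\<^sup>2 + 2 * (norm (A' t))\<^sup>2"
      using sum_squares_bound[of "norm (A t)" "norm (A' t)"] by (simp add: power2_sum)
    finally show ?thesis .
  qed
  then show "AE t in I. norm ((norm (A t - A' t))\<^sup>2) \<le> norm (2 * (norm (A t))\<^sup>2 + 2 * (norm (A' t))\<^sup>2)"
    by (intro AE_I2) simp
qed (use assms[THEN admissible_measurable] in measurable)

lemma integral_norm_le_energy: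
  assumes "admissible A" and "admissible A'"
  shows "(\<integral>t. norm (A t - A' t) \<partial>I)\<^sup>2 \<le> T * energy (\<lambda>t. A t - A' t)"
  using I.square_integral_norm_le(2)[of "\<lambda>t. A t - A' t"] assms[THEN admissible_measurable]
    admissible_diff_square_integrable[OF assms]
  by (simp add: energy_def)

lemma L_integrable:
  assumes A: "admissible A" and [measurable]: "p \<in> borel_measurable I"
    and bnd: "\<And>t. t \<in> {0..T} \<Longrightarrow> norm (p t) \<le> C"
  shows "integrable I (\<lambda>t. L (p t, A t))"
proof (rule Bochner_Integration.integrable_bound)
  note [measurable] = admissible_measurable[OF A]
  show "integrable I (\<lambda>t. L (0, A t) + c1 * C)"
    using A by (simp add: admissible_def)
  show "AE t in I. norm (L (p t, A t)) \<le> norm (L (0, A t) + c1 * C)"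
  proof (rule AE_I2)
    fix t assume "t \<in> space I"
    then have "c1 * norm (p t) \<le> c1 * C"
      using c1_nonneg bnd by (intro mult_left_mono) auto
    then show "norm (L (p t, A t)) \<le> norm (L (0, A t) + c1 * C)"
      using L_lipschitz[of "p t" "A t" 0] L_nonneg[of "(p t, A t)"] by auto
  qed
  show "(\<lambda>t. L (p t, A t)) \<in> borel_measurable I"
    by measurable
qed

lemma potential_field_measurable:
  assumes "potential_field V" and [measurable]: "p \<in> borel_measurable I"
  shows "(\<lambda>t. V t (p t)) \<in> borel_measurable I"
proof -
  have "(\<lambda>(t, x). V t x) \<in> borel_measurable (I \<Otimes>\<^sub>M borel)"
    using assms(1) by (simp add: potential_field_def)
  from measurable_compose[OF _ this, of "\<lambda>t. (t, p t)" I] show ?thesis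
    by simp
qed

lemma V_integrable:
  assumes V: "potential_field V" and p: "p \<in> borel_measurable I"
    and bnd: "\<And>t. t \<in> {0..T} \<Longrightarrow> norm (p t) \<le> C"
  shows "integrable I (\<lambda>t. V t (p t))"
proof (rule Bochner_Integration.integrable_bound)
  show "integrable I (\<lambda>t. \<bar>V t 0\<bar> + B * C)"
    using V by (simp add: potential_field_def)
  show "AE t in I. norm (V t (p t)) \<le> norm (\<bar>V t 0\<bar> + B * C)"
  proof (rule AE_I2)
    fix t assume "t \<in> space I"
    then have "B * norm (p t) \<le> B * C"
      using B_nonneg bnd by (intro mult_left_mono) auto
    moreover have "\<bar>V t (p t) - V t 0\<bar> \<le> B * norm (p t - 0)"
      using V unfolding potential_field_def by blast
    ultimately show "norm (V t (p t)) \<le> norm (\<bar>V t 0\<bar> + B * C)"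
      by auto
  qed
qed (rule potential_field_measurable[OF V p])

lemma norm_path_le:
  assumes "integrable I A" and "t \<in> {0..T}"
  shows "norm (terminal_path T q A t) \<le> norm q + (\<integral>t. norm (A t) \<partial>I)"
  using path_minus_endpoint[OF assms, of q] norm_triangle_sub[of "terminal_path T q A t" q] by linarith

lemma cost_integrable:
  assumes A: "admissible A" and V: "potential_field V" and A': "integrable I A'"
  shows "integrable I (\<lambda>t. L (terminal_path T q A' t, A t))" and "integrable I (\<lambda>t. V t (terminal_path T q A' t))"
  using L_integrable[OF A path_measurable[OF A'] norm_path_le[OF A']]
    V_integrable[OF V path_measurable[OF A'] norm_path_le[OF A']] by auto

lemma admissible_of_path:
  assumes "A \<in> borel_measurable I" and "integrable I A" and "integrable I (\<lambda>t. L (terminal_path T q A t, A t))"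
  shows "admissible A"
proof -
  note [measurable] = assms(1)
  have "integrable I (\<lambda>t. L (0, A t))"
  proof (rule Bochner_Integration.integrable_bound)
    let ?C = "norm q + (\<integral>t. norm (A t) \<partial>I)"
    show "integrable I (\<lambda>t. L (terminal_path T q A t, A t) + c1 * ?C)"
      using assms(3) by simp
    show "AE t in I. norm (L (0, A t)) \<le> norm (L (terminal_path T q A t, A t) + c1 * ?C)"
    proof (rule AE_I2)
      fix t assume "t \<in> space I"
      then have "c1 * norm (terminal_path T q A t) \<le> c1 * ?C"
        using c1_nonneg norm_path_le[OF assms(2)] by (intro mult_left_mono) auto
      then show "norm (L (0, A t)) \<le> norm (L (terminal_path T q A t, A t) + c1 * ?C)"
        using L_lipschitz[of "terminal_path T q A t" "A t" 0] L_nonneg[of "(0, A t)"] by auto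
    qed
  qed measurable
  with assms(1) show ?thesis
    by (simp add: admissible_def)
qed

lemma admissible_zero: "admissible (\<lambda>_. 0)"
  by (simp add: admissible_def)

lemma admissible_midpoint:
  assumes A: "admissible A" and A': "admissible A'"
  shows "admissible (\<lambda>t. (1/2) *\<^sub>R (A t + A' t))"
proof -
  note [measurable] = A[THEN admissible_measurable] A'[THEN admissible_measurable]
  have lam: "0 \<le> lam"
    using cm_small cm_nonneg by (smt (verit) mult_nonneg_nonneg zero_le_power2)
  have "integrable I (\<lambda>t. L (0, (1/2) *\<^sub>R (A t + A' t)))"
  proof (rule Bochner_Integration.integrable_bound)
    show "integrable I (\<lambda>t. (L (0, A t) + L (0, A' t)) / 2)"
      using A A' by (simp add: admissible_def)
    have "2 * L (0, (1/2) *\<^sub>R (A t + A' t)) \<le> L (0, A t) + L (0, A' t)" for t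
      using L_midpoint[of 0 0 "A t" "A' t"] lam
      by (smt (verit) add.right_neutral divide_nonneg_pos mult_nonneg_nonneg scaleR_zero_right zero_le_power2)
    then show "AE t in I. norm (L (0, (1/2) *\<^sub>R (A t + A' t))) \<le> norm ((L (0, A t) + L (0, A' t)) / 2)"
      using L_nonneg by (intro AE_I2) (simp add: field_simps)
  qed measurable
  then show ?thesis
    by (simp add: admissible_def)
qed

lemma cost_midpoint:
  assumes V: "potential_field V" and A: "admissible A" and A': "admissible A'"
  shows "2 * cost V q (\<lambda>t. (1/2) *\<^sub>R (A t + A' t))
    \<le> cost V q A + cost V q A' - mu / 4 * energy (\<lambda>t. A t - A' t)"
proof -
  define N where "N = (\<lambda>t. (1/2) *\<^sub>R (A t + A' t))"
  note adm = A A' admissible_midpoint[OF A A', folded N_def]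
  note int = adm[THEN admissible_integrable]
  note ci = cost_integrable[OF adm(1) V int(1), of q] cost_integrable[OF adm(2) V int(2), of q]
    cost_integrable[OF adm(3) V int(3), of q]
  define E where "E = energy (\<lambda>t. A t - A' t)"
  have E: "integrable I (\<lambda>t. (norm (A t - A' t))\<^sup>2)"
    using A A' by (rule admissible_diff_square_integrable)
  have "2 * cost V q N = (\<integral>t. 2 * (L (terminal_path T q N t, N t) + V t (terminal_path T q N t)) \<partial>I)"
    unfolding cost_def by (rule integral_mult_right_zero[symmetric])
  also have "\<dots> \<le> (\<integral>t. (L (terminal_path T q A t, A t) + V t (terminal_path T q A t))
     + (L (terminal_path T q A' t, A' t) + V t (terminal_path T q A' t))
     - lam / 4 * (norm (A t - A' t))\<^sup>2 + cm / 4 * (T * E) \<partial>I)"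
  proof (rule integral_mono)
    fix t assume "t \<in> space I"
    then have t: "t \<in> {0..T}" by simp
    have mid: "terminal_path T q N t = (1/2) *\<^sub>R (terminal_path T q A t + terminal_path T q A' t)"
      unfolding N_def by (rule path_midpoint[OF int(1,2) t])
    \<comment> \<open>The bound obtained here does not depend on t, so the integration over
      \<open>{0..T}\<close> contributes a second factor T. This is the origin of
      \<open>T\<^sup>2 * cm\<close> in \<open>mu\<close>.\<close>
    have "(norm (terminal_path T q A t - terminal_path T q A' t))\<^sup>2 \<le> (\<integral>t. norm (A t - A' t) \<partial>I)\<^sup>2"
      using norm_path_diff_le[OF int(1,2) t, of q q] by (intro power_mono) auto
    also have "\<dots> \<le> T * E"
      unfolding E_def by (rule integral_norm_le_energy[OF A A'])
    finally have "cm / 4 * (norm (terminal_path T q A t - terminal_path T q A' t))\<^sup>2 \<le> cm / 4 * (T * E)"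
      using cm_nonneg by (intro mult_left_mono) auto
    moreover have "2 * V t (terminal_path T q N t) \<le> V t (terminal_path T q A t) + V t (terminal_path T q A' t)
        + cm / 4 * (norm (terminal_path T q A t - terminal_path T q A' t))\<^sup>2"
      using V unfolding mid potential_field_def by blast
    moreover have "2 * L (terminal_path T q N t, N t) \<le> L (terminal_path T q A t, A t) + L (terminal_path T q A' t, A' t)
        - lam / 4 * (norm (A t - A' t))\<^sup>2"
      unfolding mid unfolding N_def by (rule L_midpoint)
    ultimately show "2 * (L (terminal_path T q N t, N t) + V t (terminal_path T q N t))
      \<le> (L (terminal_path T q A t, A t) + V t (terminal_path T q A t)) + (L (terminal_path T q A' t, A' t) + V t (terminal_path T q A' t))
     - lam / 4 * (norm (A t - A' t))\<^sup>2 + cm / 4 * (T * E)"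
      by simp
  qed (use ci E in auto)
  also have "\<dots> = cost V q A + cost V q A' - lam / 4 * E + cm / 4 * (T * E) * T"
    using ci E unfolding cost_def E_def energy_def by simp
  finally show ?thesis
    unfolding N_def[symmetric] E_def[symmetric] mu_def
    by (simp add: field_simps power2_eq_square)
qed

text \<open>The midpoint of A and A' cannot beat A. Inserting this into the convexity inequality
  gives quadratic growth of the cost away from its minimizer.\<close>

lemma minimizer_gap:
  assumes V: "potential_field V" and A: "minimizer V q A" and A': "admissible A'"
  shows "mu / 4 * energy (\<lambda>t. A t - A' t) \<le> cost V q A' - cost V q A"
proof -
  have adm: "admissible A"
    using A by (simp add: minimizer_def)
  have "cost V q A \<le> cost V q (\<lambda>t. (1/2) *\<^sub>R (A t + A' t))"
    using A admissible_midpoint[OF adm A'] by (simp add: minimizer_def)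
  with cost_midpoint[OF V adm A', of q] show ?thesis
    by linarith
qed

text \<open>Coercivity: the potential can lower the cost by at most M T, and the Lagrangian controls
  the energy whatever the position.\<close>

lemma cost_nonneg:
  assumes V: "potential_field V" and A: "admissible A"
  shows "c0 * energy A \<le> cost V q A + M * T"
proof -
  note int = cost_integrable[OF A V admissible_integrable[OF A], of q]
  have "c0 * energy A = (\<integral>t. c0 * (norm (A t))\<^sup>2 \<partial>I)"
    by (simp add: energy_def)
  also have "\<dots> \<le> (\<integral>t. L (terminal_path T q A t, A t) + V t (terminal_path T q A t) + M \<partial>I)"
  proof (rule integral_mono)
    fix t
    show "c0 * (norm (A t))\<^sup>2 \<le> L (terminal_path T q A t, A t) + V t (terminal_path T q A t) + M"
      using L_ge[of "A t" "terminal_path T q A t"] V unfolding potential_field_def by (smt (verit))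
  qed (use int admissible_square_integrable[OF A] in auto)
  also have "\<dots> = cost V q A + M * T"
    using int by (simp add: cost_def)
  finally show ?thesis .
qed

lemma energy_nonneg: "0 \<le> energy A"
  by (simp add: energy_def)

text \<open>The direct method with strong convergence. The midpoint of two nearly optimal controls
  costs at least the infimum, which forces the controls to be close. The limit is then pointwise
  almost everywhere, and lower semicontinuity is Fatou's lemma.\<close>

lemma minimizer_exists:
  assumes V: "potential_field V"
  shows "\<exists>A. minimizer V q A"
proof -
  define m where "m = (INF A\<in>Collect admissible. cost V q A)"
  have cost_ge: "- (M * T) \<le> cost V q A" if "admissible A" for A
    using cost_nonneg[OF V that, of q] mult_nonneg_nonneg[OF less_imp_le[OF c0_pos] energy_nonneg[of A]] by linarith
  then have bdd: "bdd_below (cost V q ` Collect admissible)"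
    by (intro bdd_belowI2[of _ "- (M * T)"]) auto
  have m_le: "m \<le> cost V q A" if "admissible A" for A
    unfolding m_def using bdd that by (intro cINF_lower) auto
  \<comment> \<open>The excess (1/4)^n bounds the energy of successive differences; after the square
    root their L^1 norms are of order (1/2)^n and hence summable.\<close>
  have "\<exists>A. admissible A \<and> cost V q A < m + (1/4)^n" for n :: nat
  proof -
    have "(INF A\<in>Collect admissible. cost V q A) < m + (1/4)^n"
      by (simp add: m_def)
    then show ?thesis
      using admissible_zero bdd by (subst (asm) cINF_less_iff) auto
  qed
  then obtain A where A: "\<And>n. admissible (A n)" and A_cost: "\<And>n. cost V q (A n) < m + (1/4)^n"
    by metis
  note A_int = A[THEN admissible_integrable]
  note [measurable] = A[THEN admissible_measurable]
  define c where "c = sqrt (8 * T / mu)"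
  have step: "(\<integral>t. norm (A (Suc n) t - A n t) \<partial>I) \<le> c * (1/2)^n" for n
  proof -
    let ?E = "energy (\<lambda>t. A (Suc n) t - A n t)"
    have "2 * m \<le> cost V q (A (Suc n)) + cost V q (A n) - mu / 4 * ?E"
      using cost_midpoint[OF V A A, of q "Suc n" n] m_le[OF admissible_midpoint[OF A A, of "Suc n" n]] by linarith
    also have "\<dots> \<le> 2 * m + 2 * (1/4)^n - mu / 4 * ?E"
    proof -
      have "(0::real) \<le> (1/4)^n"
        by simp
      with A_cost[of n] A_cost[of "Suc n", unfolded power_Suc] show ?thesis
        by linarith
    qed
    finally have "?E \<le> 8 / mu * (1/4)^n"
      using mu_pos by (simp add: field_simps)
    then have "T * ?E \<le> T * (8 / mu * (1/4)^n)"
      using T_pos by (intro mult_left_mono) auto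
    then have "(\<integral>t. norm (A (Suc n) t - A n t) \<partial>I)\<^sup>2 \<le> 8 * T / mu * (1/4)^n"
      using integral_norm_le_energy[OF A A, of "Suc n" n] by (simp add: mult.commute)
    also have "\<dots> = (c * (1/2)^n)\<^sup>2"
    proof -
      have "c\<^sup>2 = 8 * T / mu"
        using T_pos mu_pos by (simp add: c_def)
      moreover have "((1/2)^n)\<^sup>2 = (1/4::real)^n"
        by (simp add: power2_eq_square flip: power_mult_distrib)
      ultimately show ?thesis
        by (simp only: power_mult_distrib)
    qed
    finally show ?thesis
      by (rule power2_le_imp_le) (use T_pos mu_pos in \<open>simp add: c_def\<close>)
  qed
  have summ: "summable (\<lambda>n. \<integral>t. norm (A (Suc n) t - A n t) \<partial>I)"
    by (rule summable_comparison_test'[where g = "\<lambda>n. c * (1/2)^n" and N = 0])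
      (auto simp: step intro!: summable_mult)
  define A' where "A' t = lim (\<lambda>n. A n t)" for t
  have [measurable]: "A' \<in> borel_measurable I"
    unfolding A'_def by measurable
  note lim = fast_L1_Cauchy_limit[OF A_int summ, folded A'_def]
  have path_conv: "(\<lambda>n. terminal_path T q (A n) t) \<longlonglongrightarrow> terminal_path T q A' t" if "t \<in> {0..T}" for t
  proof -
    have "norm (terminal_path T q (A n) t - terminal_path T q A' t) \<le> (\<integral>t. norm (A n t - A' t) \<partial>I)" for n
      using norm_path_diff_le[OF A_int lim(2) that, of q n q] by simp
    then have "(\<lambda>n. terminal_path T q (A n) t - terminal_path T q A' t) \<longlonglongrightarrow> 0"
      by (intro Lim_null_comparison[OF _ lim(3)]) auto
    then show ?thesis
      by (rule LIM_zero_cancel)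
  qed
  have V_ge: "- M \<le> V t x" for t x
    using V by (simp add: potential_field_def)
  have V_cont: "isCont (V t) x" for t x
  proof -
    have "\<bar>V t x - V t y\<bar> \<le> B * norm (x - y)" for x y
      using V by (simp add: potential_field_def)
    then have "B-lipschitz_on UNIV (V t)"
      using B_nonneg by (intro lipschitz_onI) (auto simp: dist_norm)
    then show ?thesis
      using lipschitz_on_continuous_on continuous_on_eq_continuous_at by blast
  qed
  \<comment> \<open>The shift by M makes the integrand nonnegative, as Fatou's lemma
    requires.\<close>
  define f where "f A t = L (terminal_path T q A t, A t) + V t (terminal_path T q A t) + M" for A t
  have f_nonneg: "0 \<le> f A t" for A t
    using L_nonneg V_ge by (smt (verit) f_def)
  have f_meas: "f A \<in> borel_measurable I" if [measurable]: "A \<in> borel_measurable I" and "integrable I A" for A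
  proof -
    note [measurable] = path_measurable[OF that(2), of q] potential_field_measurable[OF V path_measurable[OF that(2), of q]]
    show ?thesis
      unfolding f_def by measurable
  qed
  have f_int: "integrable I (f A)" "(\<integral>t. f A t \<partial>I) = cost V q A + M * T" if "admissible A" for A
    unfolding f_def cost_def using cost_integrable[OF that V admissible_integrable[OF that], of q] by auto
  have f_conv: "AE t in I. (\<lambda>n. f (A n) t) \<longlonglongrightarrow> f A' t"
  proof -
    have "AE t in I. t \<in> {0..T}"
      by (rule AE_I2) simp
    with lim(1) show ?thesis
    proof eventually_elim
      case (elim t)
      have "(\<lambda>n. (terminal_path T q (A n) t, A n t)) \<longlonglongrightarrow> (terminal_path T q A' t, A' t)"
        by (intro tendsto_Pair path_conv elim)
      moreover have "isCont L z" for z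
        using L_cont by (cases z) (simp add: continuous_on_eq_continuous_at)
      ultimately have "(\<lambda>n. L (terminal_path T q (A n) t, A n t)) \<longlonglongrightarrow> L (terminal_path T q A' t, A' t)"
        by (rule isCont_tendsto_compose[rotated])
      moreover have "(\<lambda>n. V t (terminal_path T q (A n) t)) \<longlonglongrightarrow> V t (terminal_path T q A' t)"
        by (rule isCont_tendsto_compose[OF V_cont path_conv[OF elim(2)]])
      ultimately show ?case
        unfolding f_def by (intro tendsto_add tendsto_const)
    qed
  qed
  have cost_conv: "(\<lambda>n. ennreal (cost V q (A n) + M * T)) \<longlonglongrightarrow> ennreal (m + M * T)"
  proof (intro tendsto_ennrealI tendsto_add tendsto_const)
    have upper: "(\<lambda>n. m + (1/4)^n) \<longlonglongrightarrow> m"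
      using tendsto_add[OF tendsto_const LIMSEQ_power_zero[of "1/4::real"], of m] by simp
    show "(\<lambda>n. cost V q (A n)) \<longlonglongrightarrow> m"
    proof (rule tendsto_sandwich[OF _ _ tendsto_const upper])
      show "\<forall>\<^sub>F n in sequentially. m \<le> cost V q (A n)"
        using m_le[OF A] by simp
      show "\<forall>\<^sub>F n in sequentially. cost V q (A n) \<le> m + (1/4)^n"
        using A_cost by (simp add: less_imp_le)
    qed
  qed
  have "(\<integral>\<^sup>+t. ennreal (f A' t) \<partial>I) = (\<integral>\<^sup>+t. liminf (\<lambda>n. ennreal (f (A n) t)) \<partial>I)"
    using f_conv by (intro nn_integral_cong_AE) (auto elim!: eventually_mono intro!: lim_imp_Liminf[symmetric] tendsto_ennrealI)
  also have "\<dots> \<le> liminf (\<lambda>n. \<integral>\<^sup>+t. ennreal (f (A n) t) \<partial>I)"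
    using f_meas A_int by (intro nn_integral_liminf) auto
  also have "(\<lambda>n. \<integral>\<^sup>+t. ennreal (f (A n) t) \<partial>I) = (\<lambda>n. ennreal (cost V q (A n) + M * T))"
    using f_int[OF A] f_nonneg by (simp add: nn_integral_eq_integral)
  also have "liminf \<dots> = ennreal (m + M * T)"
    by (rule lim_imp_Liminf[OF _ cost_conv]) simp
  finally have fatou: "(\<integral>\<^sup>+t. ennreal (f A' t) \<partial>I) \<le> ennreal (m + M * T)" .
  \<comment> \<open>The limit is not yet known to be admissible. Fatou's bound makes the shifted
    integrand integrable; removing the potential and the shift leaves the Lagrangian along the path,
    which decides admissibility.\<close>
  have "integrable I (f A')"
    using fatou f_meas[OF _ lim(2)] f_nonneg
    by (intro integrableI_nonneg) (auto intro: le_less_trans ennreal_less_top)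
  moreover have "integrable I (\<lambda>t. V t (terminal_path T q A' t))"
    using cost_integrable(2)[OF admissible_zero V lim(2)] .
  ultimately have "integrable I (\<lambda>t. f A' t - V t (terminal_path T q A' t) - M)"
    by simp
  then have "admissible A'"
    using lim(2) unfolding f_def by (intro admissible_of_path) auto
  moreover have "cost V q A' \<le> m"
  proof -
    have "ennreal (cost V q A' + M * T) \<le> ennreal (m + M * T)"
      using fatou f_int[OF \<open>admissible A'\<close>] f_nonneg by (simp add: nn_integral_eq_integral)
    \<comment> \<open>\<open>ennreal\<close> sends negative numbers to 0, so the inequality
      transfers back to the reals only because the right side is nonnegative.\<close>
    moreover have "- (M * T) \<le> m"
      unfolding m_def using admissible_zero cost_ge by (intro cINF_greatest) auto
    ultimately show ?thesis
      by (simp add: ennreal_le_iff)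
  qed
  ultimately show ?thesis
    unfolding minimizer_def using m_le order_trans by blast
qed

text \<open>Each minimizer competes in the problem of the other. The sum of the two gap inequalities
  is quadratic on the left and linear on the right in the L^1 distance, which is thereby bounded.
  The hypothesis on V - V' is asked at almost every time, since it will be derived at times where
  the population averages converge.\<close>

lemma minimizer_stable_field:
  assumes V: "potential_field V" and V': "potential_field V'"
    and A: "minimizer V q A" and A': "minimizer V' q A'"
    and k: "0 \<le> \<kappa>" "AE t in I. \<forall>x y. (V t x - V' t x) - (V t y - V' t y) \<le> \<kappa> * norm (x - y)"
  shows "(\<integral>t. norm (A t - A' t) \<partial>I) \<le> 2 * \<kappa> * T\<^sup>2 / mu"
proof -
  have adm: "admissible A" "admissible A'"
    using A A' by (auto simp: minimizer_def)
  note int = adm[THEN admissible_integrable]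
  define E where "E = energy (\<lambda>t. A t - A' t)"
  define S where "S = (\<integral>t. norm (A t - A' t) \<partial>I)"
  have E': "E = energy (\<lambda>t. A' t - A t)"
    by (simp add: E_def energy_def norm_minus_commute)
  note ci = cost_integrable[OF adm(1) V int(1), of q] cost_integrable[OF adm(2) V int(2), of q]
    cost_integrable[OF adm(1) V' int(1), of q] cost_integrable[OF adm(2) V' int(2), of q]
  have "mu / 2 * E \<le> (cost V q A' - cost V q A) + (cost V' q A - cost V' q A')"
    using minimizer_gap[OF V A adm(2), folded E_def] minimizer_gap[OF V' A' adm(1), folded E'] by linarith
  \<comment> \<open>Both costs are evaluated on the same two paths, so the Lagrangian terms cancel
    and a second difference of V - V' remains.\<close>
  also have "\<dots> = (\<integral>t. (V t (terminal_path T q A' t) - V' t (terminal_path T q A' t))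
      - (V t (terminal_path T q A t) - V' t (terminal_path T q A t)) \<partial>I)"
    unfolding cost_def using ci by simp
  also have "\<dots> \<le> (\<integral>t. \<kappa> * S \<partial>I)"
  proof (rule integral_mono_AE)
    have "AE t in I. t \<in> {0..T}"
      by (rule AE_I2) simp
    with k(2) show "AE t in I. (V t (terminal_path T q A' t) - V' t (terminal_path T q A' t))
      - (V t (terminal_path T q A t) - V' t (terminal_path T q A t)) \<le> \<kappa> * S"
    proof eventually_elim
      case (elim t)
      have "norm (terminal_path T q A' t - terminal_path T q A t) \<le> S"
        using norm_path_diff_le[OF int(2,1) elim(2), of q q] by (simp add: S_def norm_minus_commute)
      then have "\<kappa> * norm (terminal_path T q A' t - terminal_path T q A t) \<le> \<kappa> * S"
        using k(1) by (rule mult_left_mono)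
      with elim show ?case
        by (meson order_trans)
    qed
  qed (use ci in auto)
  finally have "mu / 2 * E \<le> \<kappa> * S * T"
    by (simp add: mult.commute mult.left_commute)
  \<comment> \<open>The factor T prepares Cauchy-Schwarz, \<open>S\<^sup>2 \<le> T * E\<close>;
    afterwards one factor S can be divided out.\<close>
  then have "T * (mu * E) \<le> T * (2 * \<kappa> * S * T)"
    using T_pos by (intro mult_left_mono) auto
  moreover have "mu * S\<^sup>2 \<le> mu * (T * E)"
    using integral_norm_le_energy[OF adm] mu_pos unfolding S_def E_def by (intro mult_left_mono) auto
  ultimately have *: "S * (mu * S) \<le> S * (2 * \<kappa> * T\<^sup>2)"
    by (simp add: power2_eq_square algebra_simps)
  have "S \<ge> 0"
    by (simp add: S_def)
  have "mu * S \<le> 2 * \<kappa> * T\<^sup>2"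
  proof (cases "S = 0")
    case True
    then show ?thesis using k by simp
  next
    case False
    with \<open>S \<ge> 0\<close> have "0 < S" by simp
    with * show ?thesis by (simp only: mult_le_cancel_left_pos)
  qed
  then show ?thesis
    using mu_pos by (simp add: S_def[symmetric] field_simps)
qed

text \<open>With the control unchanged, moving the end point translates the whole path by q -
  q'.\<close>

lemma cost_lipschitz_endpoint:
  assumes V: "potential_field V" and A: "admissible A"
  shows "\<bar>cost V q A - cost V q' A\<bar> \<le> T * ((c1 + B) * norm (q - q'))"
proof -
  note int = admissible_integrable[OF A]
  note ci = cost_integrable[OF A V int, of q] cost_integrable[OF A V int, of q']
  have "cost V q A - cost V q' A = (\<integral>t. (L (terminal_path T q A t, A t) + V t (terminal_path T q A t))
      - (L (terminal_path T q' A t, A t) + V t (terminal_path T q' A t)) \<partial>I)"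
    unfolding cost_def using ci by simp
  then have "\<bar>cost V q A - cost V q' A\<bar> \<le> (\<integral>t. \<bar>(L (terminal_path T q A t, A t) + V t (terminal_path T q A t))
      - (L (terminal_path T q' A t, A t) + V t (terminal_path T q' A t))\<bar> \<partial>I)"
    by (simp only: flip: real_norm_def) (rule integral_norm_bound)
  also have "\<dots> \<le> (\<integral>t. (c1 + B) * norm (q - q') \<partial>I)"
  proof (rule integral_mono)
    fix t assume t: "t \<in> space I"
    have "terminal_path T q A t - terminal_path T q' A t = q - q'"
      by (simp add: terminal_path_def)
    moreover have "\<bar>V t (terminal_path T q A t) - V t (terminal_path T q' A t)\<bar> \<le> B * norm (terminal_path T q A t - terminal_path T q' A t)"
      using V by (simp add: potential_field_def)
    ultimately show "\<bar>(L (terminal_path T q A t, A t) + V t (terminal_path T q A t))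
      - (L (terminal_path T q' A t, A t) + V t (terminal_path T q' A t))\<bar> \<le> (c1 + B) * norm (q - q')"
      using L_lipschitz[of "terminal_path T q A t" "A t" "terminal_path T q' A t"]
      by (simp add: distrib_right)
  qed (use ci in auto)
  finally show ?thesis
    by simp
qed

text \<open>The cost changes linearly with the end point while the gap is quadratic in the control,
  whence the exponent 1/2. This is enough for continuity of the paths in q and for summable
  approximation of the controls.\<close>

lemma minimizer_stable_endpoint:
  assumes V: "potential_field V" and A: "minimizer V q A" and A': "minimizer V q' A'"
  shows "(\<integral>t. norm (A t - A' t) \<partial>I) \<le> 2 * T * sqrt ((c1 + B) / mu * norm (q - q'))"
proof (rule power2_le_imp_le)
  have adm: "admissible A" "admissible A'"
    using A A' by (auto simp: minimizer_def)
  define E where "E = energy (\<lambda>t. A t - A' t)"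
  have E': "E = energy (\<lambda>t. A' t - A t)"
    by (simp add: E_def energy_def norm_minus_commute)
  have "mu / 2 * E \<le> (cost V q A' - cost V q A) + (cost V q' A - cost V q' A')"
    using minimizer_gap[OF V A adm(2), folded E_def] minimizer_gap[OF V A' adm(1), folded E'] by linarith
  also have "\<dots> \<le> 2 * T * ((c1 + B) * norm (q - q'))"
    using cost_lipschitz_endpoint[OF V adm(1), of q q'] cost_lipschitz_endpoint[OF V adm(2), of q q'] by linarith
  finally have "E \<le> 4 * T * ((c1 + B) / mu * norm (q - q'))"
    using mu_pos by (simp add: field_simps)
  then have "T * E \<le> T * (4 * T * ((c1 + B) / mu * norm (q - q')))"
    using T_pos by (intro mult_left_mono) auto
  with integral_norm_le_energy[OF adm]
  have "(\<integral>t. norm (A t - A' t) \<partial>I)\<^sup>2 \<le> T * (4 * T * ((c1 + B) / mu * norm (q - q')))"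
    unfolding E_def by linarith
  also have "\<dots> = (2 * T * sqrt ((c1 + B) / mu * norm (q - q')))\<^sup>2"
    using c1_nonneg B_nonneg mu_pos by (simp add: power_mult_distrib) (simp add: power2_eq_square)
  finally show "(\<integral>t. norm (A t - A' t) \<partial>I)\<^sup>2 \<le> (2 * T * sqrt ((c1 + B) / mu * norm (q - q')))\<^sup>2" .
  show "0 \<le> 2 * T * sqrt ((c1 + B) / mu * norm (q - q'))"
    using T_pos c1_nonneg B_nonneg mu_pos by simp
qed

text \<open>Comparison with the zero control, whose cost grows at most linearly in |q|, and
  coercivity. Linear growth is what makes paths composed with an integrable \<open>Xs\<close>
  integrable.\<close>

lemma minimizer_growth:
  assumes V: "potential_field V"
  obtains C where "0 \<le> C"
    "\<And>q A t. minimizer V q A \<Longrightarrow> t \<in> {0..T} \<Longrightarrow> norm (terminal_path T q A t) \<le> C * (1 + norm q)"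
proof -
  define K where "K = T / c0 * (\<bar>cost V 0 (\<lambda>_. 0)\<bar> + M * T + T * (c1 + B))"
  have K0: "0 \<le> K"
    using T_pos c0_pos c1_nonneg B_nonneg M_nonneg by (simp add: K_def)
  have "norm (terminal_path T q A t) \<le> (2 + K) * (1 + norm q)" if A: "minimizer V q A" and t: "t \<in> {0..T}" for q A t
  proof -
    have adm: "admissible A"
      using A by (simp add: minimizer_def)
    define S where "S = (\<integral>t. norm (A t) \<partial>I)"
    have "S\<^sup>2 \<le> T * energy A"
      using integral_norm_le_energy[OF adm admissible_zero] by (simp add: S_def)
    also have "\<dots> \<le> T / c0 * (c0 * energy A)"
      using c0_pos by simp
    also have "\<dots> \<le> T / c0 * (cost V q A + M * T)"
      using c0_pos T_pos by (intro mult_left_mono cost_nonneg V adm) auto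
    also have "\<dots> \<le> T / c0 * ((\<bar>cost V 0 (\<lambda>_. 0)\<bar> + M * T + T * (c1 + B)) * (1 + norm q))"
    proof (rule mult_left_mono)
      have "cost V q A \<le> cost V q (\<lambda>_. 0)"
        using A admissible_zero by (simp add: minimizer_def)
      moreover have "\<dots> \<le> cost V 0 (\<lambda>_. 0) + T * ((c1 + B) * norm q)"
        using cost_lipschitz_endpoint[OF V admissible_zero, of q 0] by simp
      moreover have "\<bar>cost V 0 (\<lambda>_. 0)\<bar> + M * T + T * (c1 + B) * norm q
          \<le> (\<bar>cost V 0 (\<lambda>_. 0)\<bar> + M * T + T * (c1 + B)) * (1 + norm q)"
      proof -
        have "0 \<le> (\<bar>cost V 0 (\<lambda>_. 0)\<bar> + M * T) * norm q" "0 \<le> T * (c1 + B)"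
          using T_pos c1_nonneg B_nonneg M_nonneg by auto
        then show ?thesis
          by (simp add: algebra_simps)
      qed
      ultimately show "cost V q A + M * T \<le> (\<bar>cost V 0 (\<lambda>_. 0)\<bar> + M * T + T * (c1 + B)) * (1 + norm q)"
        by (simp add: mult.assoc)
    qed (use T_pos c0_pos in auto)
    finally have "S\<^sup>2 \<le> K * (1 + norm q)"
      by (simp add: K_def)
    \<comment> \<open>The bound on \<open>S\<^sup>2\<close> would give growth of order sqrt |q| for
      S; the crude linear bound suffices because the path already contains q itself.\<close>
    moreover have "S \<le> 1 + S\<^sup>2"
    proof -
      have "0 \<le> S"
        by (simp add: S_def)
      with zero_le_power2[of "S - 1"] show ?thesis
        by (simp add: power2_diff)
    qed
    moreover have "norm (terminal_path T q A t) \<le> norm q + S"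
      unfolding S_def by (rule norm_path_le[OF admissible_integrable[OF adm] t])
    moreover have "(2 + K) * (1 + norm q) = 2 * (1 + norm q) + K * (1 + norm q)"
      by (simp add: algebra_simps)
    ultimately show ?thesis
      using norm_ge_zero[of q] by argo
  qed
  with K0 show ?thesis
    by (intro that[of "2 + K"]) auto
qed

end

section \<open>The best response map\<close>

text \<open>Used with x the time and y the final position: paths are continuous in time, and
  \<open>minimizer_stable_endpoint\<close> supplies a modulus in the final position that is the same
  at all times.\<close>

lemma continuous_on_UNIV_uniform_modulus:
  fixes f :: "'a::metric_space \<Rightarrow> 'b::metric_space \<Rightarrow> 'c::real_normed_vector"
  assumes cont: "\<And>y. continuous_on UNIV (\<lambda>x. f x y)"
    and modulus: "\<And>x y y'. norm (f x y - f x y') \<le> \<omega> (dist y y')"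
    and \<omega>: "continuous_on {0..} \<omega>" "\<omega> 0 = 0"
  shows "continuous_on UNIV (\<lambda>(x, y). f x y)"
proof -
  have "isCont (\<lambda>(x, y). f x y) (x, y)" for x y
  proof -
    have "((\<lambda>p. \<omega> (dist (snd p) y)) \<longlongrightarrow> \<omega> 0) (at (x, y))"
      by (rule continuous_on_tendsto_compose[OF \<omega>(1)]) (auto intro!: tendsto_eq_intros)
    moreover have "((\<lambda>p. f (fst p) y) \<longlongrightarrow> f x y) (at (x, y))"
      using cont by (intro continuous_on_tendsto_compose[of UNIV "\<lambda>x. f x y"]) (auto intro!: tendsto_eq_intros)
    ultimately have lim: "((\<lambda>p. \<omega> (dist (snd p) y) + norm (f (fst p) y - f x y)) \<longlongrightarrow> 0) (at (x, y))"
      using \<omega>(2) by (intro tendsto_eq_intros) auto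
    have "norm (f (fst p) (snd p) - f x y) \<le> \<omega> (dist (snd p) y) + norm (f (fst p) y - f x y)" for p
      using modulus[of "fst p" "snd p" y]
        norm_triangle_ineq[of "f (fst p) (snd p) - f (fst p) y" "f (fst p) y - f x y"] by simp
    then have "((\<lambda>p. f (fst p) (snd p) - f x y) \<longlongrightarrow> 0) (at (x, y))"
      by (intro Lim_null_comparison[OF _ lim]) simp
    then show ?thesis
      unfolding isCont_def by (auto simp: case_prod_beta' dest: LIM_zero_cancel)
  qed
  then show ?thesis
    by (auto intro!: continuous_at_imp_continuous_on)
qed

locale continuum_game = control_problem L T c0 c1 lam cm B M
  for L :: "'a::euclidean_space \<times> 'a \<Rightarrow> real" and T c0 c1 lam cm B M :: real +
  fixes \<Phi> :: "'a \<Rightarrow> real" and K :: real and Xs :: "real \<Rightarrow> 'a"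
  assumes Phi_lipschitz: "\<bar>\<Phi> x - \<Phi> y\<bar> \<le> B * norm (x - y)"
    and Phi_ge: "- M \<le> \<Phi> x"
    and Phi_midpoint: "2 * \<Phi> ((1/2) *\<^sub>R (x + y)) \<le> \<Phi> x + \<Phi> y + cm / 4 * (norm (x - y))\<^sup>2"
    and Phi_second: "\<bar>(\<Phi> (x - a) - \<Phi> (x - b)) - (\<Phi> (y - a) - \<Phi> (y - b))\<bar> \<le> K * norm (a - b) * norm (x - y)"
    and K_nonneg: "0 \<le> K"
    and contraction: "2 * K * T\<^sup>2 < mu"
    and Xs_measurable: "Xs \<in> borel_measurable (lebesgue_on Omega)"
    and Xs_integrable: "integrable (lebesgue_on Omega) Xs"
begin

abbreviation W :: "real measure" where "W \<equiv> lebesgue_on Omega"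

sublocale W: finite_measure W
  by (intro finite_measure_lebesgue_on) auto

section \<open>Averages of the interaction potential over the labels\<close>

lemma measure_W [simp]: "measure W Omega = 1"
  by (simp add: measure_restrict_space)

lemma Phi_measurable [measurable]: "\<Phi> \<in> borel_measurable borel"
proof -
  have "B-lipschitz_on UNIV \<Phi>"
    using B_nonneg Phi_lipschitz by (intro lipschitz_onI) (auto simp: dist_norm)
  then show ?thesis
    by (intro borel_measurable_continuous_onI lipschitz_on_continuous_on)
qed

definition average :: "(real \<Rightarrow> 'a) \<Rightarrow> 'a \<Rightarrow> real" where
  "average z x = (\<integral>w. \<Phi> (x - z w) \<partial>W)"

lemma average_integrable_shift:
  assumes [measurable]: "z \<in> borel_measurable W" and "integrable W (\<lambda>w. \<Phi> (x - z w))"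
  shows "integrable W (\<lambda>w. \<Phi> (y - z w))"
proof (rule Bochner_Integration.integrable_bound)
  show "integrable W (\<lambda>w. \<bar>\<Phi> (x - z w)\<bar> + B * norm (y - x))"
    using assms(2) by simp
  have "norm (\<Phi> (y - z w)) \<le> norm (\<bar>\<Phi> (x - z w)\<bar> + B * norm (y - x))" for w
    using Phi_lipschitz[of "y - z w" "x - z w"] by simp
  then show "AE w in W. norm (\<Phi> (y - z w)) \<le> norm (\<bar>\<Phi> (x - z w)\<bar> + B * norm (y - x))"
    by (intro AE_I2)
qed measurable

text \<open>Integrability at one point spreads to all points because \<open>\<Phi>\<close> is
  Lipschitz. So an average is either genuine everywhere or identically 0, the default value of the
  Bochner integral, and the bounds below hold trivially in the second case.\<close>

lemma average_not_integrable:
  assumes "z \<in> borel_measurable W" and "\<not> integrable W (\<lambda>w. \<Phi> (x - z w))"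
  shows "average z y = 0"
  unfolding average_def
  by (rule not_integrable_integral_eq) (use average_integrable_shift[OF assms(1), of y x] assms(2) in blast)

lemma average_lipschitz:
  assumes z: "z \<in> borel_measurable W"
  shows "\<bar>average z x - average z y\<bar> \<le> B * norm (x - y)"
proof (cases "integrable W (\<lambda>w. \<Phi> (x - z w))")
  case True
  note int = True average_integrable_shift[OF z True, of y]
  have "average z x - average z y = (\<integral>w. \<Phi> (x - z w) - \<Phi> (y - z w) \<partial>W)"
    using int by (simp add: average_def)
  then have "\<bar>average z x - average z y\<bar> \<le> (\<integral>w. \<bar>\<Phi> (x - z w) - \<Phi> (y - z w)\<bar> \<partial>W)"
    by (simp only: flip: real_norm_def) (rule integral_norm_bound)
  also have "\<dots> \<le> (\<integral>w. B * norm (x - y) \<partial>W)"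
  proof (rule integral_mono)
    show "\<bar>\<Phi> (x - z w) - \<Phi> (y - z w)\<bar> \<le> B * norm (x - y)" for w
      using Phi_lipschitz[of "x - z w" "y - z w"] by simp
  qed (use int in auto)
  finally show ?thesis by simp
next
  case False
  then show ?thesis
    using average_not_integrable[OF z False] B_nonneg by simp
qed

lemma average_ge:
  assumes z: "z \<in> borel_measurable W"
  shows "- M \<le> average z x"
proof (cases "integrable W (\<lambda>w. \<Phi> (x - z w))")
  case True
  have "(\<integral>w. - M \<partial>W) \<le> average z x"
    unfolding average_def using True Phi_ge by (intro integral_mono) auto
  then show ?thesis by simp
next
  case False
  then show ?thesis
    using average_not_integrable[OF z False] M_nonneg by simp
qed

lemma average_midpoint:
  assumes z: "z \<in> borel_measurable W"
  shows "2 * average z ((1/2) *\<^sub>R (x + y)) \<le> average z x + average z y + cm / 4 * (norm (x - y))\<^sup>2"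
proof (cases "integrable W (\<lambda>w. \<Phi> (x - z w))")
  case True
  note int = average_integrable_shift[OF z True]
  have "2 * average z ((1/2) *\<^sub>R (x + y)) = (\<integral>w. 2 * \<Phi> ((1/2) *\<^sub>R (x + y) - z w) \<partial>W)"
    unfolding average_def by (rule integral_mult_right_zero[symmetric])
  also have "\<dots> \<le> (\<integral>w. \<Phi> (x - z w) + \<Phi> (y - z w) + cm / 4 * (norm (x - y))\<^sup>2 \<partial>W)"
  proof (rule integral_mono)
    fix w
    have "(1/2) *\<^sub>R ((x - z w) + (y - z w)) = (1/2) *\<^sub>R (x + y) - z w"
      by (simp add: algebra_simps flip: scaleR_left_distrib)
    then show "2 * \<Phi> ((1/2) *\<^sub>R (x + y) - z w) \<le> \<Phi> (x - z w) + \<Phi> (y - z w) + cm / 4 * (norm (x - y))\<^sup>2"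
      using Phi_midpoint[of "x - z w" "y - z w"] by simp
  qed (use int in auto)
  also have "\<dots> = average z x + average z y + cm / 4 * (norm (x - y))\<^sup>2"
    unfolding average_def using int by simp
  finally show ?thesis .
next
  case False
  then show ?thesis
    using average_not_integrable[OF z False] cm_nonneg by simp
qed

lemma average_second_difference:
  assumes z: "z \<in> borel_measurable W" and z': "z' \<in> borel_measurable W"
    and int: "integrable W (\<lambda>w. \<Phi> (0 - z w))" "integrable W (\<lambda>w. \<Phi> (0 - z' w))"
    and S: "\<And>w. w \<in> Omega \<Longrightarrow> norm (z w - z' w) \<le> S"
  shows "(average z x - average z' x) - (average z y - average z' y) \<le> K * S * norm (x - y)"
proof -
  note i = average_integrable_shift[OF z int(1)] average_integrable_shift[OF z' int(2)]
  have "(average z x - average z' x) - (average z y - average z' y)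
      = (\<integral>w. (\<Phi> (x - z w) - \<Phi> (x - z' w)) - (\<Phi> (y - z w) - \<Phi> (y - z' w)) \<partial>W)"
    unfolding average_def using i by simp
  also have "\<dots> \<le> (\<integral>w. K * S * norm (x - y) \<partial>W)"
  proof (rule integral_mono)
    fix w assume "w \<in> space W"
    then have "K * norm (z w - z' w) * norm (x - y) \<le> K * S * norm (x - y)"
      using S K_nonneg by (intro mult_left_mono mult_right_mono) auto
    then show "(\<Phi> (x - z w) - \<Phi> (x - z' w)) - (\<Phi> (y - z w) - \<Phi> (y - z' w)) \<le> K * S * norm (x - y)"
      using Phi_second[of x "z w" "z' w" y] by linarith
  qed (use i in auto)
  finally show ?thesis by simp
qed

text \<open>The case distinction on \<open>t\<close> makes the bounds hold at all times, measurability of the slice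
  \<open>Z t\<close> being known for \<open>t \<in> {0..T}\<close> only.\<close>

definition interaction :: "(real \<Rightarrow> real \<Rightarrow> 'a) \<Rightarrow> real \<Rightarrow> 'a \<Rightarrow> real" where
  "interaction Z t x = (if t \<in> {0..T} then average (Z t) x else 0)"

text \<open>The point 0 serves as a reference only: the Lipschitz property of \<open>\<Phi>\<close>
  carries both integrability conditions to all bounded measurable paths.\<close>

definition flow :: "(real \<Rightarrow> real \<Rightarrow> 'a) \<Rightarrow> bool" where
  "flow Z \<longleftrightarrow> (\<lambda>(t, w). Z t w) \<in> borel_measurable (I \<Otimes>\<^sub>M W) \<and>
     (AE t in I. integrable W (\<lambda>w. \<Phi> (0 - Z t w))) \<and> integrable I (\<lambda>t. interaction Z t 0)"

lemma slice_measurable: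
  assumes "(\<lambda>(t, w). Z t w) \<in> borel_measurable (I \<Otimes>\<^sub>M W)" and "t \<in> {0..T}"
  shows "Z t \<in> borel_measurable W"
  using measurable_compose[OF measurable_Pair1' assms(1), of t] assms(2) by simp

lemma interaction_measurable:
  assumes [measurable]: "(\<lambda>(t, w). Z t w) \<in> borel_measurable (I \<Otimes>\<^sub>M W)"
  shows "(\<lambda>(t, x). interaction Z t x) \<in> borel_measurable (I \<Otimes>\<^sub>M borel)"
proof -
  have "(\<lambda>p. \<integral>w. \<Phi> (snd p - Z (fst p) w) \<partial>W) \<in> borel_measurable (I \<Otimes>\<^sub>M borel)"
  proof (rule W.borel_measurable_lebesgue_integral)
    have [measurable]: "(\<lambda>(p, w). Z (fst p) w) \<in> borel_measurable ((I \<Otimes>\<^sub>M borel) \<Otimes>\<^sub>M W)"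
      using measurable_compose[OF _ assms, of "\<lambda>(p, w). (fst p, w)" "(I \<Otimes>\<^sub>M borel) \<Otimes>\<^sub>M W"]
      by (simp add: case_prod_beta')
    show "(\<lambda>(p, w). \<Phi> (snd p - Z (fst p) w)) \<in> borel_measurable ((I \<Otimes>\<^sub>M borel) \<Otimes>\<^sub>M W)"
      unfolding case_prod_beta' by (intro measurable_compose[OF _ Phi_measurable] borel_measurable_diff) (auto simp: case_prod_beta' intro: \<open>(\<lambda>(p, w). Z (fst p) w) \<in> _\<close>[unfolded case_prod_beta'])
  qed
  also have "?this \<longleftrightarrow> ?thesis"
    by (intro measurable_cong) (auto simp: interaction_def average_def space_pair_measure)
  finally show ?thesis .
qed

lemma interaction_potential_field:
  assumes "flow Z"
  shows "potential_field (interaction Z)"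
proof -
  have Z: "(\<lambda>(t, w). Z t w) \<in> borel_measurable (I \<Otimes>\<^sub>M W)" and int: "integrable I (\<lambda>t. interaction Z t 0)"
    using assms by (auto simp: flow_def)
  note s = slice_measurable[OF Z]
  show ?thesis
    unfolding potential_field_def
  proof (intro conjI allI)
    fix t x y
    show "\<bar>interaction Z t x - interaction Z t y\<bar> \<le> B * norm (x - y)"
      using average_lipschitz[OF s, of t x y] B_nonneg by (simp add: interaction_def)
    show "- M \<le> interaction Z t x"
      using average_ge[OF s, of t x] M_nonneg by (simp add: interaction_def)
    show "2 * interaction Z t ((1/2) *\<^sub>R (x + y)) \<le> interaction Z t x + interaction Z t y + cm / 4 * (norm (x - y))\<^sup>2"
      using average_midpoint[OF s, of t x y] cm_nonneg by (simp add: interaction_def)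
  qed (fact interaction_measurable[OF Z] int)+
qed

lemma interaction_second_difference:
  assumes Z: "flow Z" and Z': "flow Z'"
    and S: "\<And>t w. t \<in> {0..T} \<Longrightarrow> w \<in> Omega \<Longrightarrow> norm (Z t w - Z' t w) \<le> S"
  shows "AE t in I. \<forall>x y. (interaction Z t x - interaction Z' t x) - (interaction Z t y - interaction Z' t y)
     \<le> K * S * norm (x - y)"
proof -
  have "AE t in I. integrable W (\<lambda>w. \<Phi> (0 - Z t w))" "AE t in I. integrable W (\<lambda>w. \<Phi> (0 - Z' t w))"
    "AE t in I. t \<in> {0..T}"
    using Z Z' by (auto simp: flow_def intro: AE_I2)
  then show ?thesis
  proof eventually_elim
    case (elim t)
    have "Z t \<in> borel_measurable W" "Z' t \<in> borel_measurable W"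
      using Z Z' elim(3) by (auto simp: flow_def intro: slice_measurable)
    then show ?case
      using average_second_difference[OF _ _ elim(1,2) S] elim(3) by (auto simp: interaction_def)
  qed
qed

text \<open>The difference of any two potentials has Lipschitz constant 2 B, however far apart the
  flows are. This starts the iteration in the uniqueness proof, and it also places differences of
  best responses among the bounded functions, where Banach's theorem applies.\<close>

lemma minimizer_flow_bounded:
  assumes Z: "flow Z" and Z': "flow Z'"
    and A: "minimizer (interaction Z) q A" and A': "minimizer (interaction Z') q A'" and t: "t \<in> {0..T}"
  shows "norm (terminal_path T q A t - terminal_path T q A' t) \<le> 4 * B * T\<^sup>2 / mu"
proof -
  note V = Z[THEN interaction_potential_field] Z'[THEN interaction_potential_field]
  have "(interaction Z t x - interaction Z' t x) - (interaction Z t y - interaction Z' t y) \<le> 2 * B * norm (x - y)" for t x y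
  proof -
    have "\<bar>interaction Z t x - interaction Z t y\<bar> \<le> B * norm (x - y)"
      "\<bar>interaction Z' t x - interaction Z' t y\<bar> \<le> B * norm (x - y)"
      using V by (auto simp: potential_field_def)
    then show ?thesis by linarith
  qed
  then have "(\<integral>t. norm (A t - A' t) \<partial>I) \<le> 2 * (2 * B) * T\<^sup>2 / mu"
    using B_nonneg by (intro minimizer_stable_field[OF V A A']) auto
  moreover have "integrable I A" "integrable I A'"
    using A A' admissible_integrable by (auto simp: minimizer_def)
  ultimately show ?thesis
    using norm_path_diff_le[of T A A' t q q] t by simp
qed

section \<open>The contraction factor and the fixed point\<close>

definition rho :: real where "rho = 2 * K * T\<^sup>2 / mu"

lemma rho: "0 \<le> rho" "rho < 1"
  using K_nonneg mu_pos contraction by (auto simp: rho_def)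

lemma minimizer_flow_contraction:
  assumes Z: "flow Z" and Z': "flow Z'"
    and S: "\<And>t w. t \<in> {0..T} \<Longrightarrow> w \<in> Omega \<Longrightarrow> norm (Z t w - Z' t w) \<le> S" and "0 \<le> S"
    and A: "minimizer (interaction Z) q A" and A': "minimizer (interaction Z') q A'"
  shows "(\<integral>t. norm (A t - A' t) \<partial>I) \<le> rho * S"
proof -
  note V = Z[THEN interaction_potential_field] Z'[THEN interaction_potential_field]
  have "(\<integral>t. norm (A t - A' t) \<partial>I) \<le> 2 * (K * S) * T\<^sup>2 / mu"
    using K_nonneg \<open>0 \<le> S\<close> interaction_second_difference[OF Z Z' S]
    by (intro minimizer_stable_field[OF V A A']) auto
  then show ?thesis
    by (simp add: rho_def algebra_simps)
qed

text \<open>The choice is made for each end point separately, so at a fixed time nothing is known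
  about the dependence on q. Only the L^1 distance is controlled, hence the iteration acts on paths
  and not on controls.\<close>

definition optimal :: "(real \<Rightarrow> 'a \<Rightarrow> real) \<Rightarrow> 'a \<Rightarrow> real \<Rightarrow> 'a" where
  "optimal V q = (SOME A. minimizer V q A)"

lemma optimal: "potential_field V \<Longrightarrow> minimizer V q (optimal V q)"
  unfolding optimal_def by (rule someI_ex[OF minimizer_exists])

lemma optimal_integrable: "potential_field V \<Longrightarrow> integrable I (optimal V q)"
  using optimal admissible_integrable by (auto simp: minimizer_def)

definition clip :: "real \<Rightarrow> real" where "clip t = max 0 (min T t)"

lemma clip: "clip t \<in> {0..T}" "t \<in> {0..T} \<Longrightarrow> clip t = t"
  using T_pos by (auto simp: clip_def)

text \<open>A position field \<open>y t q\<close> gives the position at time \<open>t\<close> of the player with final position \<open>q\<close>. Times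
  are clipped to \<open>{0..T}\<close>, because bounded continuous functions are defined on the whole type.\<close>

definition best_response :: "(real \<Rightarrow> 'a \<Rightarrow> 'a) \<Rightarrow> real \<Rightarrow> 'a \<Rightarrow> 'a" where
  "best_response y t q = terminal_path T q (optimal (interaction (\<lambda>t w. y t (Xs w))) q) (clip t)"

text \<open>Fields are indexed by the final position and not by the label because best responses are
  continuous in the former. Continuity makes the composition with \<open>Xs\<close> jointly
  measurable, and linear growth makes it integrable.\<close>

definition position_field :: "(real \<Rightarrow> 'a \<Rightarrow> 'a) \<Rightarrow> bool" where
  "position_field y \<longleftrightarrow> continuous_on UNIV (\<lambda>(t, q). y t q) \<and> (\<exists>C\<ge>0. \<forall>t q. norm (y t q) \<le> C * (1 + norm q))"

lemma position_field_flow: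
  assumes y: "position_field y"
  shows "flow (\<lambda>t w. y t (Xs w))" and "t \<in> {0..T} \<Longrightarrow> integrable W (\<lambda>w. y t (Xs w))"
    and "t \<in> {0..T} \<Longrightarrow> integrable W (\<lambda>w. \<Phi> (0 - y t (Xs w)))"
proof -
  note [measurable] = Xs_measurable
  obtain C where C: "0 \<le> C" "\<And>t q. norm (y t q) \<le> C * (1 + norm q)"
    and cont: "continuous_on UNIV (\<lambda>(t, q). y t q)"
    using y unfolding position_field_def by blast
  have y_meas [measurable]: "(\<lambda>(t, q). y t q) \<in> borel_measurable (borel \<Otimes>\<^sub>M borel)"
    unfolding borel_prod using cont by (rule borel_measurable_continuous_onI)
  have [measurable]: "(\<lambda>t. t) \<in> borel_measurable I"
    by (intro measurable_restrict_space1 measurable_completion) simp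
  have "(\<lambda>p. (fst p, Xs (snd p))) \<in> I \<Otimes>\<^sub>M W \<rightarrow>\<^sub>M borel \<Otimes>\<^sub>M borel"
    by measurable
  from measurable_compose[OF this y_meas]
  have meas: "(\<lambda>(t, w). y t (Xs w)) \<in> borel_measurable (I \<Otimes>\<^sub>M W)"
    by (simp add: case_prod_beta')
  note slice = slice_measurable[OF meas]
  have int: "integrable W (\<lambda>w. y t (Xs w))" if "t \<in> {0..T}" for t
  proof (rule Bochner_Integration.integrable_bound)
    show "integrable W (\<lambda>w. C * (1 + norm (Xs w)))"
      using Xs_integrable by simp
    show "AE w in W. norm (y t (Xs w)) \<le> norm (C * (1 + norm (Xs w)))"
      using C by (intro AE_I2) (simp add: abs_mult)
  qed (rule slice[OF that])
  then show "t \<in> {0..T} \<Longrightarrow> integrable W (\<lambda>w. y t (Xs w))" .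
  have Phi_int: "integrable W (\<lambda>w. \<Phi> (0 - y t (Xs w)))"
    and bound: "norm (interaction (\<lambda>t w. y t (Xs w)) t 0) \<le> (\<integral>w. \<bar>\<Phi> 0\<bar> + B * (C * (1 + norm (Xs w))) \<partial>W)"
    if t: "t \<in> {0..T}" for t
  proof -
    have Xs_int: "integrable W (\<lambda>w. \<bar>\<Phi> 0\<bar> + B * (C * (1 + norm (Xs w))))"
      using Xs_integrable by simp
    have le: "norm (\<Phi> (0 - y t (Xs w))) \<le> \<bar>\<Phi> 0\<bar> + B * (C * (1 + norm (Xs w)))" for w
    proof -
      have "B * norm (y t (Xs w)) \<le> B * (C * (1 + norm (Xs w)))"
        using B_nonneg C by (intro mult_left_mono) auto
      then show ?thesis
        using Phi_lipschitz[of "0 - y t (Xs w)" 0] by simp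
    qed
    have [measurable]: "(\<lambda>w. y t (Xs w)) \<in> borel_measurable W"
      by (rule slice[OF t])
    show *: "integrable W (\<lambda>w. \<Phi> (0 - y t (Xs w)))"
    proof (rule Bochner_Integration.integrable_bound[OF Xs_int])
      show "AE w in W. norm (\<Phi> (0 - y t (Xs w))) \<le> norm (\<bar>\<Phi> 0\<bar> + B * (C * (1 + norm (Xs w))))"
        using le by (intro AE_I2) (metis abs_ge_self order_trans real_norm_def)
    qed measurable
    have "norm (interaction (\<lambda>t w. y t (Xs w)) t 0) \<le> (\<integral>w. norm (\<Phi> (0 - y t (Xs w))) \<partial>W)"
      using t unfolding interaction_def average_def by (simp only: if_True) (rule integral_norm_bound)
    also have "\<dots> \<le> (\<integral>w. \<bar>\<Phi> 0\<bar> + B * (C * (1 + norm (Xs w))) \<partial>W)"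
      using * Xs_int le by (intro integral_mono) auto
    finally show "norm (interaction (\<lambda>t w. y t (Xs w)) t 0) \<le> (\<integral>w. \<bar>\<Phi> 0\<bar> + B * (C * (1 + norm (Xs w))) \<partial>W)" .
  qed
  show "t \<in> {0..T} \<Longrightarrow> integrable W (\<lambda>w. \<Phi> (0 - y t (Xs w)))"
    by (rule Phi_int)
  have "(\<lambda>t. interaction (\<lambda>t w. y t (Xs w)) t 0) \<in> borel_measurable I"
    using measurable_compose[OF _ interaction_measurable[OF meas], of "\<lambda>t. (t, 0)" I] by simp
  then have "integrable I (\<lambda>t. interaction (\<lambda>t w. y t (Xs w)) t 0)"
    by (intro I.integrable_const_bound[where B = "\<integral>w. \<bar>\<Phi> 0\<bar> + B * (C * (1 + norm (Xs w))) \<partial>W"])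
      (use bound in \<open>auto intro!: AE_I2\<close>)
  then show "flow (\<lambda>t w. y t (Xs w))"
    unfolding flow_def using meas Phi_int by (auto intro!: AE_I2)
qed

lemma best_response_position_field:
  assumes y: "position_field y"
  shows "position_field (best_response y)"
proof -
  define V where "V = interaction (\<lambda>t w. y t (Xs w))"
  have V: "potential_field V"
    unfolding V_def using y by (intro interaction_potential_field position_field_flow)
  note int = optimal_integrable[OF V]
  have "continuous_on UNIV (\<lambda>(t, q). best_response y t q)"
  proof (rule continuous_on_UNIV_uniform_modulus)
    fix q
    show "continuous_on UNIV (\<lambda>t. best_response y t q)"
      unfolding best_response_def V_def[symmetric]
      by (rule continuous_on_compose2[OF continuous_on_path[OF int]])
        (use T_pos in \<open>auto simp: clip_def[abs_def] intro!: continuous_intros\<close>)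
  next
    fix t q q'
    have "norm (best_response y t q - best_response y t q')
        \<le> norm (q - q') + (\<integral>s. norm (optimal V q s - optimal V q' s) \<partial>I)"
      unfolding best_response_def V_def[symmetric] by (rule norm_path_diff_le[OF int int clip(1)])
    also have "\<dots> \<le> norm (q - q') + 2 * T * sqrt ((c1 + B) / mu * norm (q - q'))"
      by (intro add_left_mono minimizer_stable_endpoint[OF V optimal optimal] V)
    finally show "norm (best_response y t q - best_response y t q')
        \<le> (\<lambda>d. d + 2 * T * sqrt ((c1 + B) / mu * d)) (dist q q')"
      by (simp add: dist_norm)
  qed (use T_pos mu_pos in \<open>auto intro!: continuous_intros\<close>)
  moreover obtain C where "0 \<le> C"
    "\<And>q A t. minimizer V q A \<Longrightarrow> t \<in> {0..T} \<Longrightarrow> norm (terminal_path T q A t) \<le> C * (1 + norm q)"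
    using minimizer_growth[OF V] by blast
  ultimately show ?thesis
    unfolding position_field_def best_response_def V_def[symmetric]
    using optimal[OF V] clip(1) by blast
qed

lemma best_response_bounded:
  assumes "position_field y" and "position_field y'"
  shows "norm (best_response y t q - best_response y' t q) \<le> 4 * B * T\<^sup>2 / mu"
proof -
  note flow = assms[THEN position_field_flow(1)]
  show ?thesis
    unfolding best_response_def
    by (rule minimizer_flow_bounded[OF flow flow[THEN interaction_potential_field, THEN optimal] clip(1)])
qed

lemma best_response_contraction:
  assumes y: "position_field y" and y': "position_field y'" and S: "\<And>t q. norm (y t q - y' t q) \<le> S"
  shows "norm (best_response y t q - best_response y' t q) \<le> rho * S"
proof -
  note flow = y[THEN position_field_flow(1)] y'[THEN position_field_flow(1)]
  note V = flow[THEN interaction_potential_field]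
  have "0 \<le> S"
    using S[of 0 0] norm_ge_zero order_trans by blast
  then have "(\<integral>t. norm (optimal (interaction (\<lambda>t w. y t (Xs w))) q t - optimal (interaction (\<lambda>t w. y' t (Xs w))) q t) \<partial>I) \<le> rho * S"
    using S by (intro minimizer_flow_contraction[OF flow _ _ optimal[OF V(1)] optimal[OF V(2)]]) auto
  then show ?thesis
    unfolding best_response_def
    using norm_path_diff_le[OF optimal_integrable[OF V(1), of q] optimal_integrable[OF V(2), of q] clip(1)[of t], of q q]
    by simp
qed

text \<open>All best responses lie at bounded distance from \<open>base\<close>, the best response
  to one arbitrary field. Writing fields as \<open>base\<close> plus a bounded continuous function
  turns the best response map into a contraction of a Banach space.\<close>

lemma best_response_fixed_point:
  obtains y where "position_field y" "\<And>t q. best_response y t q = y t q"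
proof -
  define base where "base = best_response (\<lambda>t q. q)"
  define field where "field b t q = base t q + apply_bcontfun b (t, q)" for b :: "(real \<times> 'a) \<Rightarrow>\<^sub>C 'a" and t q
  have "position_field (\<lambda>t q. q)"
    unfolding position_field_def
    by (auto simp: case_prod_beta' intro!: continuous_intros exI[of _ 1])
  then have base: "position_field base" and base_bnd: "\<And>y t q. position_field y \<Longrightarrow> norm (best_response y t q - base t q) \<le> 4 * B * T\<^sup>2 / mu"
    unfolding base_def by (auto intro: best_response_position_field best_response_bounded)
  have field: "position_field (field b)" for b
  proof -
    obtain C where C: "0 \<le> C" "\<And>t q. norm (base t q) \<le> C * (1 + norm q)"
      and cont: "continuous_on UNIV (\<lambda>(t, q). base t q)"
      using base unfolding position_field_def by blast
    have "norm (field b t q) \<le> (C + norm b) * (1 + norm q)" for t q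
    proof -
      have "norm (field b t q) \<le> C * (1 + norm q) + norm b"
        unfolding field_def using C norm_bounded[of b "(t, q)"]
        by (intro order_trans[OF norm_triangle_ineq]) (intro add_mono, auto)
      also have "\<dots> \<le> (C + norm b) * (1 + norm q)"
        by (simp add: algebra_simps)
      finally show ?thesis .
    qed
    moreover have "continuous_on UNIV (\<lambda>(t, q). field b t q)"
      using cont unfolding field_def case_prod_beta' by (auto intro!: continuous_intros)
    ultimately show ?thesis
      using C(1) unfolding position_field_def by (meson add_nonneg_nonneg norm_ge_zero)
  qed
  define G where "G b = Bcontfun (\<lambda>(t, q). best_response (field b) t q - base t q)" for b
  have G: "apply_bcontfun (G b) (t, q) = best_response (field b) t q - base t q" for b t q
  proof -
    have "(\<lambda>(t, q). best_response (field b) t q - base t q) \<in> bcontfun"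
    proof (rule bcontfun_normI)
      show "continuous_on UNIV (\<lambda>(t, q). best_response (field b) t q - base t q)"
        using base best_response_position_field[OF field, of b] unfolding position_field_def case_prod_beta'
        by (auto intro!: continuous_intros)
      show "norm (case p of (t, q) \<Rightarrow> best_response (field b) t q - base t q) \<le> 4 * B * T\<^sup>2 / mu" for p
        using base_bnd[OF field] by (auto split: prod.split)
    qed
    then show ?thesis
      by (simp add: G_def Bcontfun_inverse)
  qed
  have "\<exists>!b. G b = b"
  proof (rule banach_fix_type[OF rho], intro allI)
    fix b b'
    show "dist (G b) (G b') \<le> rho * dist b b'"
    proof (rule dist_bound)
      fix p :: "real \<times> 'a"
      obtain t q where p: "p = (t, q)" by fastforce
      have "norm (field b t q - field b' t q) \<le> dist b b'" for t q
        using dist_bounded[of b "(t, q)" b'] by (simp add: field_def dist_norm)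
      from best_response_contraction[OF field field this]
      show "dist (apply_bcontfun (G b) p) (apply_bcontfun (G b') p) \<le> rho * dist b b'"
        unfolding p G by (simp add: dist_norm)
    qed
  qed
  then obtain b where b: "G b = b" by blast
  have "best_response (field b) t q = field b t q" for t q
    using G[of b t q] unfolding b by (simp add: field_def)
  with field show ?thesis
    by (rule that)
qed

end

section \<open>Measurability and extended real integrals\<close>

lemma measurable_lebesgue_if_null_vimage:
  fixes f :: "'a::euclidean_space \<Rightarrow> 'b::euclidean_space"
  assumes f: "f \<in> borel_measurable borel" and null: "\<And>A. A \<in> null_sets lborel \<Longrightarrow> f -` A \<in> null_sets lborel"
  shows "f \<in> measurable lebesgue lebesgue"
proof (rule completion.measurable_completion2)
  show f': "f \<in> measurable lebesgue lborel"
    using f by (intro measurable_completion) simp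
  show "null_sets lborel \<subseteq> null_sets (distr lebesgue lborel f)"
  proof
    fix A :: "'b set" assume A: "A \<in> null_sets lborel"
    then show "A \<in> null_sets (distr lebesgue lborel f)"
      unfolding null_sets_distr_iff[OF f'] using null_sets_completionI[OF null[OF A]] null_setsD2[OF A] by simp
  qed
qed

lemma measurable_fst_lebesgue:
  "fst \<in> measurable (lebesgue :: ('a::euclidean_space \<times> 'b::euclidean_space) measure) lebesgue"
proof (rule measurable_lebesgue_if_null_vimage)
  fix A :: "'a set" assume "A \<in> null_sets lborel"
  then have "A \<times> UNIV \<in> null_sets (lborel \<Otimes>\<^sub>M (lborel :: 'b measure))"
    by (auto simp: null_sets_def lborel.emeasure_pair_measure_Times)
  moreover have "fst -` A = A \<times> (UNIV :: 'b set)"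
    by auto
  ultimately show "fst -` A \<in> null_sets (lborel :: ('a \<times> 'b) measure)"
    by (simp add: lborel_prod)
qed (simp add: borel_prod[symmetric])

lemma measurable_snd_lebesgue:
  "snd \<in> measurable (lebesgue :: ('a::euclidean_space \<times> 'b::euclidean_space) measure) lebesgue"
proof (rule measurable_lebesgue_if_null_vimage)
  fix A :: "'b set" assume "A \<in> null_sets lborel"
  then have "UNIV \<times> A \<in> null_sets ((lborel :: 'a measure) \<Otimes>\<^sub>M lborel)"
    by (auto simp: null_sets_def lborel.emeasure_pair_measure_Times)
  moreover have "snd -` A = (UNIV :: 'a set) \<times> A"
    by auto
  ultimately show "snd -` A \<in> null_sets (lborel :: ('a \<times> 'b) measure)"
    by (simp add: lborel_prod)
qed (simp add: borel_prod[symmetric])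

text \<open>The product of the completed sigma-algebras is contained in the completion of the
  product. The constructed control is measurable for the former, and
  \<open>collective_control\<close> asks for the latter.\<close>

lemma measurable_lebesgue_on_pair:
  "(\<lambda>p. (fst p, snd p)) \<in> measurable (lebesgue_on (S \<times> S')) (lebesgue_on S \<Otimes>\<^sub>M lebesgue_on S')"
proof (rule measurable_Pair)
  show "fst \<in> measurable (lebesgue_on (S \<times> S')) (lebesgue_on S)"
    by (rule measurable_restrict_space3[OF measurable_fst_lebesgue]) auto
  show "snd \<in> measurable (lebesgue_on (S \<times> S')) (lebesgue_on S')"
    by (rule measurable_restrict_space3[OF measurable_snd_lebesgue]) auto
qed

text \<open>Time is rounded down to multiples of 1/(n + 1). Each approximation glues countably many
  measurable slices, and continuity in time gives pointwise convergence.\<close>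

lemma Caratheodory_measurable:
  fixes Z :: "real \<Rightarrow> 'w \<Rightarrow> 'a::euclidean_space"
  assumes T: "0 \<le> T" and meas: "\<And>t. t \<in> {0..T} \<Longrightarrow> Z t \<in> borel_measurable N"
    and cont: "\<And>w. w \<in> space N \<Longrightarrow> continuous_on {0..T} (\<lambda>t. Z t w)"
  shows "(\<lambda>(t, w). Z t w) \<in> borel_measurable (lebesgue_on {0..T} \<Otimes>\<^sub>M N)"
proof (rule borel_measurable_LIMSEQ_metric)
  define k where "k n t = nat \<lfloor>real (Suc n) * t\<rfloor>" for n t
  \<comment> \<open>The gluing runs over all natural indices k, also over those whose time exceeds
    T; the minimum keeps every sampled slice inside \<open>{0..T}\<close>.\<close>
  define Y where "Y n k p = Z (min T (real k / real (Suc n))) (snd p)" for n k and p :: "real \<times> 'w"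
  have id [measurable]: "(\<lambda>t. t) \<in> borel_measurable (lebesgue_on {0..T})"
    by (intro measurable_restrict_space1 measurable_completion) simp
  have k: "(\<lambda>p. k n (fst p)) \<in> measurable (lebesgue_on {0..T} \<Otimes>\<^sub>M N) (count_space UNIV)" for n
  proof -
    have [measurable]: "fst \<in> borel_measurable (lebesgue_on {0..T} \<Otimes>\<^sub>M N)"
      using measurable_compose[OF measurable_fst id] by simp
    show ?thesis
      unfolding k_def by measurable
  qed
  show "(\<lambda>p. Y n (k n (fst p)) p) \<in> borel_measurable (lebesgue_on {0..T} \<Otimes>\<^sub>M N)" for n
  proof (rule measurable_compose_countable[OF _ k])
    fix i
    have "Z (min T (real i / real (Suc n))) \<in> borel_measurable N"
      using T by (intro meas) auto
    then show "Y n i \<in> borel_measurable (lebesgue_on {0..T} \<Otimes>\<^sub>M N)"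
      unfolding Y_def by (rule measurable_compose[OF measurable_snd])
  qed
  fix p assume "p \<in> space (lebesgue_on {0..T} \<Otimes>\<^sub>M N)"
  then obtain t w where p: "p = (t, w)" and t: "t \<in> {0..T}" and w: "w \<in> space N"
    by (auto simp: space_pair_measure)
  define s where "s n = real (k n t) / real (Suc n)" for n
  have s: "t - 1 / real (Suc n) \<le> s n" "s n \<le> t" "0 \<le> s n" for n
  proof -
    have "real (k n t) = real_of_int \<lfloor>real (Suc n) * t\<rfloor>"
      using t by (simp add: k_def)
    then have "real (k n t) \<le> real (Suc n) * t" "real (Suc n) * t - 1 \<le> real (k n t)"
      by linarith+
    then have "(real (Suc n) * t - 1) / real (Suc n) \<le> s n" "s n \<le> (real (Suc n) * t) / real (Suc n)"
      unfolding s_def by (intro divide_right_mono; simp)+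
    moreover have "0 \<le> s n"
      by (simp add: s_def)
    ultimately show "t - 1 / real (Suc n) \<le> s n" "s n \<le> t" "0 \<le> s n"
      by (simp_all add: diff_divide_distrib)
  qed
  have "(\<lambda>n. t - 1 / real (Suc n)) \<longlonglongrightarrow> t"
    using tendsto_diff[OF tendsto_const LIMSEQ_inverse_real_of_nat, of t] by (simp add: inverse_eq_divide)
  then have "s \<longlonglongrightarrow> t"
    by (rule tendsto_sandwich[OF _ _ _ tendsto_const, rotated 2]) (use s in auto)
  then have "(\<lambda>n. Z (s n) w) \<longlonglongrightarrow> Z t w"
    using s t by (intro continuous_on_tendsto_compose[OF cont[OF w]]) (auto intro!: always_eventually order_trans[OF s(2)])
  moreover have "Y n (k n (fst p)) p = Z (s n) w" for n
    using s(2)[of n] t by (auto simp: Y_def s_def p min_absorb2)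
  ultimately show "(\<lambda>n. Y n (k n (fst p)) p) \<longlonglongrightarrow> (case p of (t, w) \<Rightarrow> Z t w)"
    by (simp add: p)
qed

lemma lebesgue_ex_borel_measurable:
  fixes f :: "'a::euclidean_space \<Rightarrow> 'b::euclidean_space"
  assumes f: "f \<in> borel_measurable lebesgue"
  obtains g where "g \<in> borel_measurable borel" "AE x in lborel. f x = g x"
proof -
  have "\<exists>g. g \<in> borel_measurable lborel \<and> (AE x in lborel. inner (f x) b = g x)" for b
    using completion_ex_borel_measurable_real[of "\<lambda>x. inner (f x) b" lborel] f by auto
  then obtain g where g: "\<And>b. g b \<in> borel_measurable lborel" "\<And>b. AE x in lborel. inner (f x) b = g b x"
    by metis
  have "AE x in lborel. \<forall>b\<in>Basis. inner (f x) b = g b x"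
    using g(2) by (subst AE_finite_all) auto
  then have "AE x in lborel. f x = (\<Sum>b\<in>Basis. g b x *\<^sub>R b)"
  proof eventually_elim
    case (elim x)
    then have "(\<Sum>b\<in>Basis. g b x *\<^sub>R b) = (\<Sum>b\<in>Basis. inner (f x) b *\<^sub>R b)"
      by (intro sum.cong) auto
    then show ?case
      by (simp add: euclidean_representation)
  qed
  moreover have "(\<lambda>x. \<Sum>b\<in>Basis. g b x *\<^sub>R b) \<in> borel_measurable borel"
    using g(1) by simp
  ultimately show ?thesis
    using that by blast
qed

lemma trajectory_eq_path: "trajectory T Xs \<alpha> t w = terminal_path T (Xs w) (\<lambda>s. \<alpha> s w) t"
  by (simp add: trajectory_def terminal_path_def)

text \<open>The control is measurable only for the completed planar measure. It agrees with a Borel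
  function outside a planar null set, almost every label sees that set in a null set of times, and
  completeness of the measure on labels absorbs the exceptional ones.\<close>

lemma collective_control_integral_measurable:
  fixes \<alpha> :: "real \<Rightarrow> real \<Rightarrow> 'a::euclidean_space"
  assumes \<alpha>: "collective_control T \<alpha>" and t: "t \<in> {0..T}"
  shows "(\<lambda>w. \<integral>s. \<alpha> s w \<partial>lebesgue_on {t..T}) \<in> borel_measurable (lebesgue_on Omega)"
proof -
  define f where "f p = (if p \<in> {0..T} \<times> Omega then \<alpha> (fst p) (snd p) else 0)" for p
  have S: "{0..T} \<times> Omega \<in> sets (lebesgue :: (real \<times> real) measure)"
    by (metis borel_Times atLeastAtMost_borel greaterThanLessThan_borel sets_completionI_sets sets_lborel)
  have "f \<in> borel_measurable lebesgue"
    unfolding f_def using \<alpha> by (intro borel_measurable_if_I[OF _ S]) (simp add: collective_control_def case_prod_beta')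
  then obtain g where g: "g \<in> borel_measurable borel" and "AE p in lborel. f p = g p"
    using lebesgue_ex_borel_measurable by blast
  then obtain N where N: "N \<in> null_sets lborel" "{p. f p \<noteq> g p} \<subseteq> N"
    by (auto elim!: AE_E simp: null_sets_def)
  have "AE p in lborel \<Otimes>\<^sub>M lborel. p \<notin> N"
    unfolding lborel_prod using N(1) by (rule AE_not_in)
  then have "AE s in lborel. AE w in lborel. (s, w) \<notin> N"
    by (rule lborel_pair.AE_pair)
  moreover have "{p \<in> space (lborel \<Otimes>\<^sub>M lborel). (case p of (s, w) \<Rightarrow> (s, w) \<notin> N)} \<in> sets (lborel \<Otimes>\<^sub>M (lborel :: real measure))"
  proof -
    have "{p \<in> space (lborel \<Otimes>\<^sub>M lborel). (case p of (s, w) \<Rightarrow> (s, w) \<notin> N)} = - N"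
      by (auto simp: space_pair_measure)
    then show ?thesis
      using N(1) unfolding lborel_prod by auto
  qed
  \<comment> \<open>The product measure gives first almost every time and then almost every label.
    The time integral for a fixed label needs the opposite order.\<close>
  ultimately have "AE w in lborel. AE s in lborel. (s, w) \<notin> N"
    using lborel_pair.AE_commute[of "\<lambda>s w. (s, w) \<notin> N"] by (simp add: case_prod_beta')
  then have "AE w in lborel. AE s in lborel. f (s, w) = g (s, w)"
    using N(2) by (auto elim!: eventually_mono)
  define h where "h w = (\<integral>s. indicator {t..T} s *\<^sub>R g (s, w) \<partial>lborel)" for w
  have g' [measurable]: "(\<lambda>(w, s). g (s, w)) \<in> borel_measurable (borel \<Otimes>\<^sub>M lborel)"
  proof -
    have "g \<in> borel_measurable (borel \<Otimes>\<^sub>M borel)"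
      using g by (simp add: borel_prod)
    from measurable_compose[OF measurable_Pair[OF measurable_snd measurable_fst] this]
    have "(\<lambda>p. g (snd p, fst p)) \<in> borel_measurable (borel \<Otimes>\<^sub>M borel)"
      by simp
    then show ?thesis
      by (simp add: case_prod_beta' cong: measurable_cong_sets)
  qed
  have h: "h \<in> borel_measurable borel"
    unfolding h_def by measurable
  have eq: "(\<integral>s. \<alpha> s w \<partial>lebesgue_on {t..T}) = h w"
    if w: "w \<in> Omega" and ae: "AE s in lborel. f (s, w) = g (s, w)" for w
  proof -
    have "integrable (lebesgue_on {0..T}) (\<lambda>s. \<alpha> s w)"
      using \<alpha> w by (simp add: collective_control_def)
    then have "integrable (lebesgue_on {t..T}) (\<lambda>s. \<alpha> s w)"
      using integrable_subinterval[of 0 T "\<lambda>s. \<alpha> s w" t T] t by auto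
    then have m1: "(\<lambda>s. indicator {t..T} s *\<^sub>R \<alpha> s w) \<in> borel_measurable lebesgue"
      by (auto simp: integrable_restrict_space)
    have gw: "(\<lambda>s. g (s, w)) \<in> borel_measurable borel"
      using measurable_compose[OF measurable_Pair1'[of w borel lborel] g'] by simp
    then have m2: "(\<lambda>s. indicator {t..T} s *\<^sub>R g (s, w)) \<in> borel_measurable lborel"
      by measurable
    have "(\<integral>s. \<alpha> s w \<partial>lebesgue_on {t..T}) = (\<integral>s. indicator {t..T} s *\<^sub>R \<alpha> s w \<partial>lebesgue)"
      by (simp add: integral_restrict_space)
    also have "\<dots> = (\<integral>s. indicator {t..T} s *\<^sub>R g (s, w) \<partial>lebesgue)"
    proof (rule integral_cong_AE[OF m1 measurable_completion[OF m2]])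
      have "AE s in lebesgue. f (s, w) = g (s, w)"
        using ae by (rule AE_completion)
      then show "AE s in lebesgue. indicator {t..T} s *\<^sub>R \<alpha> s w = indicator {t..T} s *\<^sub>R g (s, w)"
        by eventually_elim (use w t in \<open>auto simp: f_def indicator_def split: if_splits\<close>)
    qed
    also have "\<dots> = h w"
      unfolding h_def by (rule integral_completion[OF m2])
    finally show ?thesis .
  qed
  have "(\<lambda>w. if w \<in> Omega then h w else 0) \<in> borel_measurable lebesgue"
  proof (rule measurable_completion)
    have "(\<lambda>w. if w \<in> Omega then h w else 0) \<in> borel_measurable borel"
      using h by measurable
    then show "(\<lambda>w. if w \<in> Omega then h w else 0) \<in> borel_measurable lborel"
      by simp
  qed
  moreover have "AE w in lebesgue. (if w \<in> Omega then h w else 0)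
      = (if w \<in> Omega then \<integral>s. \<alpha> s w \<partial>lebesgue_on {t..T} else 0)"
    using AE_completion[OF \<open>AE w in lborel. AE s in lborel. f (s, w) = g (s, w)\<close>]
    by eventually_elim (simp add: eq)
  ultimately have "(\<lambda>w. if w \<in> Omega then \<integral>s. \<alpha> s w \<partial>lebesgue_on {t..T} else 0) \<in> borel_measurable lebesgue"
    by (rule borel_measurable_AE)
  then show ?thesis
    by (rule borel_measurable_if_D)
qed

lemma trajectory_measurable:
  assumes T: "0 \<le> T" and \<alpha>: "collective_control T \<alpha>" and Xs: "Xs \<in> borel_measurable (lebesgue_on Omega)"
  shows "(\<lambda>(t, w). trajectory T Xs \<alpha> t w) \<in> borel_measurable (lebesgue_on {0..T} \<Otimes>\<^sub>M lebesgue_on Omega)"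
proof (rule Caratheodory_measurable[OF T])
  show "trajectory T Xs \<alpha> t \<in> borel_measurable (lebesgue_on Omega)" if "t \<in> {0..T}" for t
    unfolding trajectory_def[abs_def]
    using Xs collective_control_integral_measurable[OF \<alpha> that] by (rule borel_measurable_diff)
  show "continuous_on {0..T} (\<lambda>t. trajectory T Xs \<alpha> t w)" if "w \<in> space (lebesgue_on Omega)" for w
    unfolding trajectory_eq_path
    using \<alpha> that by (intro continuous_on_path) (simp add: collective_control_def)
qed

lemma ereal_integral_eq_integral:
  assumes g: "integrable M g"
  shows "ereal_integral M (\<lambda>x. ereal (g x)) = ereal (\<integral>x. g x \<partial>M)"
proof -
  have eq: "enn2ereal P = ereal (enn2real P)" if "P \<noteq> \<infinity>" for P
    using that by (cases P) auto
  have "(\<integral>\<^sup>+x. ennreal (g x) \<partial>M) \<noteq> \<infinity>" "(\<integral>\<^sup>+x. ennreal (- g x) \<partial>M) \<noteq> \<infinity>"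
    using g by (auto simp: real_integrable_def)
  then show ?thesis
    by (simp add: ereal_integral_def real_lebesgue_integral_def[OF g] eq)
qed

text \<open>In \<open>ereal\<close>, \<infinity> - \<infinity> is \<infinity>, so a finite
  difference excludes an infinite value of either part.\<close>

lemma ereal_integral_finiteD:
  assumes "\<bar>ereal_integral M f\<bar> \<noteq> \<infinity>"
  shows "(\<integral>\<^sup>+x. e2ennreal (f x) \<partial>M) \<noteq> \<infinity>" and "(\<integral>\<^sup>+x. e2ennreal (- f x) \<partial>M) \<noteq> \<infinity>"
  using assms unfolding ereal_integral_def
  by (cases "\<integral>\<^sup>+x. e2ennreal (f x) \<partial>M" rule: ennreal_cases;
      cases "\<integral>\<^sup>+x. e2ennreal (- f x) \<partial>M" rule: ennreal_cases; simp)+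

lemma ereal_integral_integrable:
  assumes "\<bar>ereal_integral M (\<lambda>x. ereal (g x))\<bar> \<noteq> \<infinity>" and "g \<in> borel_measurable M"
  shows "integrable M g"
  using ereal_integral_finiteD[OF assms(1)] assms(2) by (simp add: real_integrable_def)

lemma ereal_integral_cong_AE:
  assumes "AE x in M. f x = g x"
  shows "ereal_integral M f = ereal_integral M g"
proof -
  have "(\<integral>\<^sup>+x. e2ennreal (f x) \<partial>M) = (\<integral>\<^sup>+x. e2ennreal (g x) \<partial>M)"
    "(\<integral>\<^sup>+x. e2ennreal (- f x) \<partial>M) = (\<integral>\<^sup>+x. e2ennreal (- g x) \<partial>M)"
    using assms by (auto intro!: nn_integral_cong_AE elim!: eventually_mono)
  then show ?thesis
    by (simp add: ereal_integral_def)
qed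

lemma ereal_add_finiteD:
  fixes a b :: ereal
  assumes "\<bar>a + b\<bar> \<noteq> \<infinity>"
  shows "\<bar>a\<bar> \<noteq> \<infinity>" "\<bar>b\<bar> \<noteq> \<infinity>"
  using assms by (cases a; cases b; simp)+

section \<open>Nash equilibria\<close>

context control_problem
begin

lemma path_cong_AE:
  assumes A: "A \<in> borel_measurable I" and A': "A' \<in> borel_measurable I" and ae: "AE t in I. A' t = A t"
    and t: "t \<in> {0..T}"
  shows "terminal_path T q A' t = terminal_path T q A t"
proof -
  have sub: "{t..T} \<subseteq> {0..T}"
    using t by auto
  have "AE s in lebesgue. s \<in> {0..T} \<longrightarrow> A' s = A s"
    using ae by (subst (asm) AE_restrict_space_iff) auto
  then have "AE s in lebesgue_on {t..T}. A' s = A s"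
    by (subst AE_restrict_space_iff) (use sub in \<open>auto elim!: eventually_mono\<close>)
  then show ?thesis
    unfolding terminal_path_def
    using integral_cong_AE[OF measurable_restrict_mono[OF A' sub] measurable_restrict_mono[OF A sub]] by simp
qed

lemma minimizer_cong_AE:
  assumes V: "potential_field V" and A: "minimizer V q A" and A': "A' \<in> borel_measurable I" and ae: "AE t in I. A' t = A t"
  shows "minimizer V q A'"
proof -
  note [measurable] = A'
  have adm: "admissible A"
    using A by (simp add: minimizer_def)
  note [measurable] = admissible_measurable[OF adm]
  have "integrable I (\<lambda>t. L (0, A' t))"
  proof (rule integrable_cong_AE_imp[of I "\<lambda>t. L (0, A t)"])
    show "integrable I (\<lambda>t. L (0, A t))"
      using adm by (simp add: admissible_def)
    show "AE t in I. L (0, A t) = L (0, A' t)"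
      using ae by eventually_elim simp
  qed measurable
  then have adm': "admissible A'"
    using A' by (simp add: admissible_def)
  have "AE t in I. t \<in> {0..T}"
    by (rule AE_I2) simp
  with ae have eq: "AE t in I. L (terminal_path T q A' t, A' t) + V t (terminal_path T q A' t)
      = L (terminal_path T q A t, A t) + V t (terminal_path T q A t)"
    by eventually_elim (simp add: path_cong_AE[OF admissible_measurable[OF adm] A' ae])
  have "cost V q A' = cost V q A"
    unfolding cost_def
    using cost_integrable[OF adm' V admissible_integrable[OF adm']] cost_integrable[OF adm V admissible_integrable[OF adm]]
    by (intro integral_cong_AE eq borel_measurable_integrable) auto
  with A adm' show ?thesis
    by (simp add: minimizer_def)
qed

text \<open>Minimizers are defined for each final position separately and, as elements of \<open>L\<^sup>1\<close>, depend
  continuously on it. Evaluating at nearby points of a countable dense set gives jointly measurable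
  functions, and their limit represents the minimizers.\<close>

lemma jointly_measurable_minimizer:
  assumes V: "potential_field V" and f: "\<And>q. minimizer V q (f q)"
  obtains A where "(\<lambda>(t, q). A t q) \<in> borel_measurable (I \<Otimes>\<^sub>M borel)" "\<And>q. AE t in I. A t q = f q t"
proof -
  obtain D :: "'a set" where D: "countable D" "\<And>X. open X \<Longrightarrow> X \<noteq> {} \<Longrightarrow> \<exists>d\<in>D. d \<in> X"
    using countable_dense_setE by blast
  define d where "d = from_nat_into D"
  \<comment> \<open>Choosing the least index makes the choice measurable in q. The radii (1/16)^n
    turn into L^1 distances of order (1/4)^n under the square root in
    \<open>minimizer_stable_endpoint\<close>, which are summable.\<close>
  define near where "near n q = (LEAST i. dist (d i) q < (1/16)^n)" for n :: nat and q :: 'a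
  have near: "dist (d (near n q)) q < (1/16)^n" for n q
  proof -
    have "0 < (1/16::real)^n"
      by simp
    then have "ball q ((1/16)^n) \<noteq> {}"
      by (metis centre_in_ball empty_iff)
    then have "\<exists>x\<in>D. x \<in> ball q ((1/16)^n)"
      by (rule D(2)[OF open_ball])
    then obtain x where "x \<in> D" "dist x q < (1/16)^n"
      by (auto simp: dist_commute)
    moreover obtain i where "d i = x"
      unfolding d_def using from_nat_into_surj[OF D(1) \<open>x \<in> D\<close>] by blast
    ultimately show ?thesis
      unfolding near_def by (intro LeastI[of "\<lambda>i. dist (d i) q < (1/16)^n" i]) simp
  qed
  have near_meas: "near n \<in> measurable borel (count_space UNIV)" for n
    unfolding near_def by measurable
  define F where "F n t q = f (d (near n q)) t" for n t q
  have f_meas: "f q \<in> borel_measurable I" and f_int: "integrable I (f q)" for q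
    using f[of q] by (simp_all add: minimizer_def admissible_measurable admissible_integrable)
  have F_meas: "(\<lambda>p. F n (fst p) (snd p)) \<in> borel_measurable (I \<Otimes>\<^sub>M borel)" for n
    unfolding F_def
  proof (rule measurable_compose_countable[where g = "\<lambda>p. near n (snd p)"])
    show "(\<lambda>p. f (d i) (fst p)) \<in> borel_measurable (I \<Otimes>\<^sub>M borel)" for i
      by (rule measurable_compose[OF measurable_fst f_meas])
    show "(\<lambda>p. near n (snd p)) \<in> measurable (I \<Otimes>\<^sub>M borel) (count_space UNIV)"
      by (rule measurable_compose[OF measurable_snd near_meas])
  qed
  define A where "A t q = lim (\<lambda>n. F n t q)" for t q
  have A_meas: "(\<lambda>p. A (fst p) (snd p)) \<in> borel_measurable (I \<Otimes>\<^sub>M borel)"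
    unfolding A_def by (intro borel_measurable_lim_metric F_meas)
  define C where "C = (c1 + B) / mu"
  have C: "0 \<le> C"
    using c1_nonneg B_nonneg mu_pos by (simp add: C_def)
  have stable: "(\<integral>t. norm (f q t - f q' t) \<partial>I) \<le> 2 * T * sqrt (2 * C) * (1/4)^n"
    if "norm (q - q') \<le> 2 * (1/16)^n" for q q' and n :: nat
  proof -
    have "(\<integral>t. norm (f q t - f q' t) \<partial>I) \<le> 2 * T * sqrt (C * norm (q - q'))"
      unfolding C_def by (rule minimizer_stable_endpoint[OF V f f])
    also have "\<dots> \<le> 2 * T * sqrt (C * (2 * (1/16)^n))"
      using that C T_pos by (intro mult_left_mono real_sqrt_le_mono) auto
    also have "C * (2 * (1/16)^n) = 2 * C * ((1/4)^n)\<^sup>2"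
      by (simp add: power2_eq_square flip: power_mult_distrib)
    also have "sqrt \<dots> = sqrt (2 * C) * (1/4)^n"
      using C by (simp add: real_sqrt_mult)
    finally show ?thesis by simp
  qed
  have "AE t in I. A t q = f q t" for q
  proof -
    have F_int: "integrable I (\<lambda>t. F n t q)" for n
      unfolding F_def by (rule f_int)
    have F_step: "(\<integral>t. norm (F (Suc n) t q - F n t q) \<partial>I) \<le> 2 * T * sqrt (2 * C) * (1/4)^n" for n
      unfolding F_def
    proof (rule stable)
      have "norm (d (near (Suc n) q) - d (near n q)) \<le> dist (d (near (Suc n) q)) q + dist (d (near n q)) q"
        unfolding dist_norm[symmetric] by (rule dist_triangle2)
      also have "\<dots> \<le> (1/16)^(Suc n) + (1/16)^n"
        using near[of "Suc n" q] near[of n q] by simp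
      also have "\<dots> \<le> 2 * (1/16)^n"
        by simp
      finally show "norm (d (near (Suc n) q) - d (near n q)) \<le> 2 * (1/16)^n" .
    qed
    have F_f: "(\<integral>t. norm (F n t q - f q t) \<partial>I) \<le> 2 * T * sqrt (2 * C) * (1/4)^n" for n
      unfolding F_def
    proof (rule stable)
      have "(0::real) \<le> (1/16)^n"
        by simp
      with near[of n q] show "norm (d (near n q) - q) \<le> 2 * (1/16)^n"
        unfolding dist_norm by linarith
    qed
    have "summable (\<lambda>n. \<integral>t. norm (F (Suc n) t q - F n t q) \<partial>I)"
      by (rule summable_comparison_test'[where g = "\<lambda>n. 2 * T * sqrt (2 * C) * (1/4)^n" and N = 0])
        (use F_step in \<open>auto intro!: summable_mult summable_geometric\<close>)
    note lim = fast_L1_Cauchy_limit[of I "\<lambda>n t. F n t q", OF F_int this, folded A_def]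
    have "(\<lambda>n. (\<integral>t. norm (F n t q - A t q) \<partial>I) + 2 * T * sqrt (2 * C) * (1/4)^n) \<longlonglongrightarrow> 0 + 2 * T * sqrt (2 * C) * 0"
      by (intro tendsto_add tendsto_mult tendsto_const lim(3) LIMSEQ_power_zero) simp
    moreover have "(\<integral>t. norm (A t q - f q t) \<partial>I) \<le> (\<integral>t. norm (F n t q - A t q) \<partial>I) + 2 * T * sqrt (2 * C) * (1/4)^n" for n
    proof -
      have "(\<integral>t. norm (A t q - f q t) \<partial>I) \<le> (\<integral>t. norm (F n t q - A t q) + norm (F n t q - f q t) \<partial>I)"
        using f_int F_int lim(2)
        by (intro integral_mono) (auto simp: norm_minus_commute intro!: norm_diff_triangle_le)
      also have "\<dots> = (\<integral>t. norm (F n t q - A t q) \<partial>I) + (\<integral>t. norm (F n t q - f q t) \<partial>I)"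
        using f_int F_int lim(2) by simp
      finally show ?thesis
        using F_f[of n] by linarith
    qed
    ultimately have "(\<integral>t. norm (A t q - f q t) \<partial>I) \<le> 0"
      by (intro LIMSEQ_le_const[of _ 0]) auto
    then have "(\<integral>t. norm (A t q - f q t) \<partial>I) = 0"
      by (intro antisym) auto
    moreover have "integrable I (\<lambda>t. norm (A t q - f q t))"
      using f_int lim(2) by simp
    ultimately show ?thesis
      by (subst (asm) integral_nonneg_eq_0_iff_AE) auto
  qed
  with A_meas show ?thesis
    by (intro that[of A]) (simp add: case_prod_beta')
qed

text \<open>For a non-integrable control the path may involve the default value of the Bochner
  integral. This is harmless because the quadratic lower bound on L does not depend on the position:
  a finite cost would make the control square integrable and then admissible.\<close>

lemma infinite_running_cost:
  assumes A: "A \<in> borel_measurable I" and not: "\<not> admissible A"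
  shows "ereal_integral I (\<lambda>t. ereal (L (terminal_path T q A t, A t))) = \<infinity>"
proof -
  note [measurable] = A
  have top: "(\<integral>\<^sup>+t. ennreal (L (terminal_path T q A t, A t)) \<partial>I) = \<infinity>"
  proof (rule ccontr)
    assume "(\<integral>\<^sup>+t. ennreal (L (terminal_path T q A t, A t)) \<partial>I) \<noteq> \<infinity>"
    then have fin: "(\<integral>\<^sup>+t. ennreal (L (terminal_path T q A t, A t)) \<partial>I) < \<infinity>"
      by (simp add: less_top)
    have "(\<integral>\<^sup>+t. ennreal (c0 * (norm (A t))\<^sup>2) \<partial>I) \<le> (\<integral>\<^sup>+t. ennreal (L (terminal_path T q A t, A t)) \<partial>I)"
      by (intro nn_integral_mono ennreal_leI L_ge)
    then have "integrable I (\<lambda>t. c0 * (norm (A t))\<^sup>2)"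
      using fin c0_pos by (intro integrableI_nonneg) (auto intro: le_less_trans)
    then have "integrable I (\<lambda>t. (norm (A t))\<^sup>2)"
      using c0_pos by simp
    then have int: "integrable I A"
      by (rule I.square_integral_norm_le(1)[OF A])
    note [measurable] = path_measurable[OF int, of q]
    have "integrable I (\<lambda>t. L (terminal_path T q A t, A t))"
      using fin L_nonneg by (intro integrableI_nonneg) auto
    with A int have "admissible A"
      by (rule admissible_of_path)
    with not show False ..
  qed
  have "(\<integral>\<^sup>+t. e2ennreal (- ereal (L (terminal_path T q A t, A t))) \<partial>I) = 0"
    using L_nonneg by (simp add: ennreal_neg)
  with top show ?thesis
    by (simp add: ereal_integral_def)
qed

end

locale nash_game = continuum_game L T c0 c1 lam cm B M \<Phi> K Xs
  for L :: "'a::euclidean_space \<times> 'a \<Rightarrow> real" and T c0 c1 lam cm B M :: real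
    and \<Phi> :: "'a \<Rightarrow> real" and K :: real and Xs :: "real \<Rightarrow> 'a" +
  fixes \<Psi> :: "'a \<Rightarrow> real" and B' :: real
  assumes Psi_lipschitz: "\<bar>\<Psi> x - \<Psi> y\<bar> \<le> B' * norm (x - y)" and B'_nonneg: "0 \<le> B'"
    and non_atomic: "{w \<in> Omega. Xs w = q} \<in> null_sets lebesgue"
begin

section \<open>Costs under unilateral deviations\<close>

lemma Psi_measurable [measurable]: "\<Psi> \<in> borel_measurable borel"
proof -
  have "B'-lipschitz_on UNIV \<Psi>"
    using B'_nonneg Psi_lipschitz by (intro lipschitz_onI) (auto simp: dist_norm)
  then show ?thesis
    by (intro borel_measurable_continuous_onI lipschitz_on_continuous_on)
qed

text \<open>This is where non-atomicity enters: all labels that deviate together with a player form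
  a null set.\<close>

lemma AE_other_label: "AE w in W. Xs w \<noteq> q"
proof -
  have "AE w in lebesgue. w \<notin> {w \<in> Omega. Xs w = q}"
    by (rule AE_not_in[OF non_atomic])
  then show ?thesis
    by (subst AE_restrict_space_iff) (auto elim!: eventually_mono)
qed

text \<open>It covers \<open>\<alpha>\<close> itself and every unilateral deviation from it, so one
  cost formula serves both sides of the equilibrium inequality.\<close>

definition same_for_others :: "real \<Rightarrow> (real \<Rightarrow> real \<Rightarrow> 'a) \<Rightarrow> (real \<Rightarrow> real \<Rightarrow> 'a) \<Rightarrow> bool" where
  "same_for_others w0 \<alpha> \<beta> \<longleftrightarrow> (\<forall>w. Xs w \<noteq> Xs w0 \<longrightarrow> (\<forall>t. \<beta> t w = \<alpha> t w))"

lemma AE_same_trajectory: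
  assumes "same_for_others w0 \<alpha> \<beta>"
  shows "AE w in W. trajectory T Xs \<beta> t w = trajectory T Xs \<alpha> t w"
  using AE_other_label[of "Xs w0"]
  by eventually_elim (use assms in \<open>simp add: same_for_others_def trajectory_def\<close>)

lemma player_cost_same_for_others:
  assumes "same_for_others w0 \<alpha> \<beta>"
  shows "player_cost L \<Phi> \<Psi> T Xs w0 \<beta> =
     ereal_integral I (\<lambda>t. ereal (L (terminal_path T (Xs w0) (\<lambda>t. \<beta> t w0) t, \<beta> t w0)))
   + ereal_integral I (\<lambda>t. ereal_integral W
       (\<lambda>w. ereal (\<Phi> (terminal_path T (Xs w0) (\<lambda>t. \<beta> t w0) t - trajectory T Xs \<alpha> t w))))
   + ereal_integral W (\<lambda>w. ereal (\<Psi> (Xs w0 - trajectory T Xs \<alpha> 0 w)))"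
proof -
  have "ereal_integral W (\<lambda>w. ereal (g (trajectory T Xs \<beta> t w)))
      = ereal_integral W (\<lambda>w. ereal (g (trajectory T Xs \<alpha> t w)))" for g t
    using AE_same_trajectory[OF assms, of t] by (intro ereal_integral_cong_AE) (auto elim!: eventually_mono)
  from this[of "\<lambda>z. \<Phi> (_ - z)"] this[of "\<lambda>z. \<Psi> (Xs w0 - z)"] show ?thesis
    unfolding player_cost_def trajectory_eq_path[of T Xs \<beta>, symmetric] by simp
qed

lemma player_cost_not_admissible:
  assumes "same_for_others w0 \<alpha> \<beta>" and "(\<lambda>t. \<beta> t w0) \<in> borel_measurable I" and "\<not> admissible (\<lambda>t. \<beta> t w0)"
  shows "player_cost L \<Phi> \<Psi> T Xs w0 \<beta> = \<infinity>"
  unfolding player_cost_same_for_others[OF assms(1)] infinite_running_cost[OF assms(2,3)] by simp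

lemma interaction_cost:
  assumes Z: "flow Z" and p: "p \<in> borel_measurable I"
  shows "AE t in I. ereal_integral W (\<lambda>w. ereal (\<Phi> (p t - Z t w))) = ereal (interaction Z t (p t))"
proof -
  have "AE t in I. integrable W (\<lambda>w. \<Phi> (0 - Z t w))" "AE t in I. t \<in> {0..T}"
    using Z by (auto simp: flow_def intro: AE_I2)
  then show ?thesis
  proof eventually_elim
    case (elim t)
    have "Z t \<in> borel_measurable W"
      using Z elim(2) by (auto simp: flow_def intro: slice_measurable)
    from ereal_integral_eq_integral[OF average_integrable_shift[OF this elim(1)]] elim(2) show ?case
      by (simp add: interaction_def average_def)
  qed
qed

lemma player_cost_admissible:
  assumes same: "same_for_others w0 \<alpha> \<beta>" and adm: "admissible (\<lambda>t. \<beta> t w0)"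
    and Z: "flow (trajectory T Xs \<alpha>)" and Psi: "integrable W (\<lambda>w. \<Psi> (Xs w0 - trajectory T Xs \<alpha> 0 w))"
  shows "player_cost L \<Phi> \<Psi> T Xs w0 \<beta> =
    ereal (cost (interaction (trajectory T Xs \<alpha>)) (Xs w0) (\<lambda>t. \<beta> t w0)
      + (\<integral>w. \<Psi> (Xs w0 - trajectory T Xs \<alpha> 0 w) \<partial>W))"
proof -
  note int = admissible_integrable[OF adm]
  note ci = cost_integrable[OF adm interaction_potential_field[OF Z] int, of "Xs w0"]
  show ?thesis
    unfolding player_cost_same_for_others[OF same] ereal_integral_eq_integral[OF Psi]
      ereal_integral_cong_AE[OF interaction_cost[OF Z path_measurable[OF int]]]
      ereal_integral_eq_integral[OF ci(1)] ereal_integral_eq_integral[OF ci(2)]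
    using ci by (simp add: cost_def)
qed

text \<open>The finite cost of one player already regularizes the whole population. The interaction
  term makes the averages converge along that player's path at almost every time, and the Lipschitz
  property moves them to the reference point 0.\<close>

lemma finite_player_costD:
  assumes \<alpha>: "collective_control T \<alpha>" and w0: "w0 \<in> Omega" and fin: "\<bar>player_cost L \<Phi> \<Psi> T Xs w0 \<alpha>\<bar> \<noteq> \<infinity>"
  shows "admissible (\<lambda>t. \<alpha> t w0)" and "flow (trajectory T Xs \<alpha>)"
    and "integrable W (\<lambda>w. \<Psi> (Xs w0 - trajectory T Xs \<alpha> 0 w))"
proof -
  let ?Z = "trajectory T Xs \<alpha>" and ?p = "terminal_path T (Xs w0) (\<lambda>t. \<alpha> t w0)"
  have same: "same_for_others w0 \<alpha> \<alpha>"
    by (simp add: same_for_others_def)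
  note fin' = fin[unfolded player_cost_same_for_others[OF same]]
  note fin1 = ereal_add_finiteD(1)[OF ereal_add_finiteD(1)[OF fin']]
  note fin2 = ereal_add_finiteD(2)[OF ereal_add_finiteD(1)[OF fin']]
  note fin3 = ereal_add_finiteD(2)[OF fin']
  have int: "integrable I (\<lambda>t. \<alpha> t w0)"
    using \<alpha> w0 by (simp add: collective_control_def)
  show adm: "admissible (\<lambda>t. \<alpha> t w0)"
    using fin1 infinite_running_cost[OF borel_measurable_integrable[OF int], of "Xs w0"] by fastforce
  note p [measurable] = path_measurable[OF int, of "Xs w0"]
  have Z: "(\<lambda>(t, w). ?Z t w) \<in> borel_measurable (I \<Otimes>\<^sub>M W)"
    using T_pos by (intro trajectory_measurable \<alpha> Xs_measurable) simp
  note Z_slice = slice_measurable[OF Z]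
  have [measurable]: "?Z 0 \<in> borel_measurable W"
    using T_pos by (intro Z_slice) simp
  show "integrable W (\<lambda>w. \<Psi> (Xs w0 - ?Z 0 w))"
    by (rule ereal_integral_integrable[OF fin3]) measurable
  have Phi_meas: "(\<lambda>(t, w). \<Phi> (?p t - ?Z t w)) \<in> borel_measurable (I \<Otimes>\<^sub>M W)"
  proof -
    have "(\<lambda>q. ?p (fst q) - ?Z (fst q) (snd q)) \<in> borel_measurable (I \<Otimes>\<^sub>M W)"
      using Z by (intro borel_measurable_diff measurable_compose[OF measurable_fst p]) (simp add: case_prod_beta')
    from measurable_compose[OF this Phi_measurable] show ?thesis
      by (simp add: case_prod_beta')
  qed
  define J where "J t = ereal_integral W (\<lambda>w. ereal (\<Phi> (?p t - ?Z t w)))" for t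
  have J_meas [measurable]: "J \<in> borel_measurable I"
  proof -
    have [measurable]: "(\<lambda>t. \<integral>\<^sup>+w. ennreal (\<Phi> (?p t - ?Z t w)) \<partial>W) \<in> borel_measurable I"
      "(\<lambda>t. \<integral>\<^sup>+w. ennreal (- \<Phi> (?p t - ?Z t w)) \<partial>W) \<in> borel_measurable I"
      using Phi_meas by (intro W.borel_measurable_nn_integral; simp add: case_prod_beta')+
    show ?thesis
      unfolding J_def ereal_integral_def by simp
  qed
  have "AE t in I. e2ennreal (J t) \<noteq> \<infinity>" "AE t in I. e2ennreal (- J t) \<noteq> \<infinity>"
    using ereal_integral_finiteD[OF fin2] unfolding J_def[symmetric]
    by (intro nn_integral_PInf_AE; measurable)+
  moreover have "AE t in I. t \<in> {0..T}"
    by (rule AE_I2) simp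
  ultimately have ae: "AE t in I. integrable W (\<lambda>w. \<Phi> (0 - ?Z t w))"
  proof eventually_elim
    case (elim t)
    have "\<bar>J t\<bar> \<noteq> \<infinity>"
      using elim(1,2) by (cases "J t") auto
    then have "integrable W (\<lambda>w. \<Phi> (?p t - ?Z t w))"
      unfolding J_def
      by (rule ereal_integral_integrable) (intro measurable_compose[OF _ Phi_measurable] borel_measurable_diff borel_measurable_const Z_slice elim(3))
    then show ?case
      by (rule average_integrable_shift[OF Z_slice[OF elim(3)]])
  qed
  have "AE t in I. J t = ereal (interaction ?Z t (?p t))"
    using ae \<open>AE t in I. t \<in> {0..T}\<close>
  proof eventually_elim
    case (elim t)
    then show ?case
      using ereal_integral_eq_integral[OF average_integrable_shift[OF Z_slice elim(1)]]
      by (simp add: J_def interaction_def average_def)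
  qed
  then have "ereal_integral I J = ereal_integral I (\<lambda>t. ereal (interaction ?Z t (?p t)))"
    by (rule ereal_integral_cong_AE)
  then have "\<bar>ereal_integral I (\<lambda>t. ereal (interaction ?Z t (?p t)))\<bar> \<noteq> \<infinity>"
    using fin2 unfolding J_def[symmetric] by simp
  moreover note V_meas = interaction_measurable[OF Z]
  have V_p: "(\<lambda>t. interaction ?Z t (g t)) \<in> borel_measurable I" if "g \<in> borel_measurable I" for g
    using measurable_compose[OF measurable_Pair[OF measurable_ident_sets[OF refl] that] V_meas] by simp
  ultimately have int_p: "integrable I (\<lambda>t. interaction ?Z t (?p t))"
    using V_p[OF p] by (intro ereal_integral_integrable)
  have "integrable I (\<lambda>t. interaction ?Z t 0)"
  proof (rule Bochner_Integration.integrable_bound)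
    let ?C = "norm (Xs w0) + (\<integral>t. norm (\<alpha> t w0) \<partial>I)"
    show "integrable I (\<lambda>t. \<bar>interaction ?Z t (?p t)\<bar> + B * ?C)"
      using int_p by simp
    show "AE t in I. norm (interaction ?Z t 0) \<le> norm (\<bar>interaction ?Z t (?p t)\<bar> + B * ?C)"
    proof (rule AE_I2)
      fix t assume "t \<in> space I"
      then have t: "t \<in> {0..T}" by simp
      have "\<bar>interaction ?Z t 0 - interaction ?Z t (?p t)\<bar> \<le> B * norm (?p t)"
        using average_lipschitz[OF Z_slice[OF t], of 0 "?p t"] t by (simp add: interaction_def)
      also have "\<dots> \<le> B * ?C"
        by (intro mult_left_mono norm_path_le int t B_nonneg)
      finally show "norm (interaction ?Z t 0) \<le> norm (\<bar>interaction ?Z t (?p t)\<bar> + B * ?C)"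
        by simp
    qed
    show "(\<lambda>t. interaction ?Z t 0) \<in> borel_measurable I"
      by (rule V_p) simp
  qed
  with Z ae show "flow ?Z"
    by (simp add: flow_def)
qed

lemma nash_equilibrium_iff:
  assumes \<alpha>: "collective_control T \<alpha>"
  shows "nash_equilibrium L \<Phi> \<Psi> T Xs \<alpha> \<longleftrightarrow> flow (trajectory T Xs \<alpha>) \<and>
    (\<forall>w0\<in>Omega. integrable W (\<lambda>w. \<Psi> (Xs w0 - trajectory T Xs \<alpha> 0 w)) \<and>
       minimizer (interaction (trajectory T Xs \<alpha>)) (Xs w0) (\<lambda>t. \<alpha> t w0))"
    (is "?nash \<longleftrightarrow> ?opt")
proof
  assume nash: ?nash
  then have fin: "\<bar>player_cost L \<Phi> \<Psi> T Xs w0 \<alpha>\<bar> \<noteq> \<infinity>" if "w0 \<in> Omega" for w0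
    using that by (simp add: nash_equilibrium_def)
  note facts = finite_player_costD[OF \<alpha> _ fin]
  have Z: "flow (trajectory T Xs \<alpha>)"
    \<comment> \<open>Any label in \<open>Omega\<close> would do.\<close>
    using facts(2)[of "1/2"] by simp
  have "minimizer (interaction (trajectory T Xs \<alpha>)) (Xs w0) (\<lambda>t. \<alpha> t w0)" if w0: "w0 \<in> Omega" for w0
    unfolding minimizer_def
  proof (intro conjI allI impI)
    show "admissible (\<lambda>t. \<alpha> t w0)"
      using facts(1) w0 by blast
    fix A :: "real \<Rightarrow> 'a" assume A: "admissible A"
    let ?\<beta> = "deviation Xs \<alpha> w0 A"
    have same: "same_for_others w0 \<alpha> ?\<beta>" "same_for_others w0 \<alpha> \<alpha>" and \<beta>: "(\<lambda>t. ?\<beta> t w0) = A"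
      by (auto simp: same_for_others_def deviation_def)
    have "player_cost L \<Phi> \<Psi> T Xs w0 \<alpha> \<le> player_cost L \<Phi> \<Psi> T Xs w0 ?\<beta>"
      using nash w0 admissible_measurable[OF A] by (simp add: nash_equilibrium_def)
    then show "cost (interaction (trajectory T Xs \<alpha>)) (Xs w0) (\<lambda>t. \<alpha> t w0)
        \<le> cost (interaction (trajectory T Xs \<alpha>)) (Xs w0) A"
      using player_cost_admissible[OF same(1) _ Z] player_cost_admissible[OF same(2) _ Z] facts w0 A
      unfolding \<beta> by simp
  qed
  with Z facts(3) show ?opt
    by blast
next
  assume opt: ?opt
  then have Z: "flow (trajectory T Xs \<alpha>)" ..
  show ?nash
    unfolding nash_equilibrium_def
  proof (intro conjI \<alpha> ballI)
    fix w0 assume "w0 \<in> Omega"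
    with opt have Psi: "integrable W (\<lambda>w. \<Psi> (Xs w0 - trajectory T Xs \<alpha> 0 w))"
      and min: "minimizer (interaction (trajectory T Xs \<alpha>)) (Xs w0) (\<lambda>t. \<alpha> t w0)"
      by auto
    have "same_for_others w0 \<alpha> \<alpha>"
      by (simp add: same_for_others_def)
    from player_cost_admissible[OF this _ Z Psi] min
    have cost: "player_cost L \<Phi> \<Psi> T Xs w0 \<alpha> = ereal (cost (interaction (trajectory T Xs \<alpha>)) (Xs w0) (\<lambda>t. \<alpha> t w0)
      + (\<integral>w. \<Psi> (Xs w0 - trajectory T Xs \<alpha> 0 w) \<partial>W))"
      by (simp add: minimizer_def)
    then show "\<bar>player_cost L \<Phi> \<Psi> T Xs w0 \<alpha>\<bar> \<noteq> \<infinity>"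
      by simp
    fix A :: "real \<Rightarrow> 'a" assume A: "A \<in> borel_measurable I"
    let ?\<beta> = "deviation Xs \<alpha> w0 A"
    have same: "same_for_others w0 \<alpha> ?\<beta>" and \<beta>: "(\<lambda>t. ?\<beta> t w0) = A"
      by (auto simp: same_for_others_def deviation_def)
    show "player_cost L \<Phi> \<Psi> T Xs w0 \<alpha> \<le> player_cost L \<Phi> \<Psi> T Xs w0 ?\<beta>"
    proof (cases "admissible A")
      case True
      then show ?thesis
        using player_cost_admissible[OF same _ Z Psi] min cost unfolding \<beta> by (simp add: minimizer_def)
    next
      case False
      then show ?thesis
        using player_cost_not_admissible[OF same] A unfolding \<beta> by simp
    qed
  qed
qed

text \<open>The fixed point provides positions only. Controls are read off from a jointly measurable
  representative of the minimizers, evaluated at the final position of each label.\<close>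

lemma nash_equilibrium_exists: "\<exists>\<alpha>. nash_equilibrium L \<Phi> \<Psi> T Xs \<alpha>"
proof -
  obtain y where y: "position_field y" "\<And>t q. best_response y t q = y t q"
    using best_response_fixed_point by blast
  define V where "V = interaction (\<lambda>t w. y t (Xs w))"
  have V: "potential_field V"
    unfolding V_def by (intro interaction_potential_field position_field_flow y)
  obtain A where A: "(\<lambda>(t, q). A t q) \<in> borel_measurable (I \<Otimes>\<^sub>M borel)"
    and A_ae: "\<And>q. AE t in I. A t q = optimal V q t"
    using jointly_measurable_minimizer[OF V optimal[OF V]] by blast
  define \<alpha> where "\<alpha> t w = A t (Xs w)" for t w
  have A_meas: "(\<lambda>t. A t q) \<in> borel_measurable I" for q
    using measurable_compose[OF measurable_Pair[OF measurable_ident_sets[OF refl] measurable_const] A, of q] by simp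
  have min: "minimizer V (Xs w) (\<lambda>t. \<alpha> t w)" for w
    unfolding \<alpha>_def by (rule minimizer_cong_AE[OF V optimal[OF V] A_meas A_ae])
  have \<alpha>: "collective_control T \<alpha>"
    unfolding collective_control_def
  proof
    have "(\<lambda>p. (fst p, Xs (snd p))) \<in> measurable (I \<Otimes>\<^sub>M W) (I \<Otimes>\<^sub>M borel)"
      by (intro measurable_Pair measurable_fst measurable_compose[OF measurable_snd Xs_measurable])
    from measurable_compose[OF measurable_lebesgue_on_pair measurable_compose[OF this A]]
    show "(\<lambda>(t, w). \<alpha> t w) \<in> borel_measurable (lebesgue_on ({0..T} \<times> Omega))"
      by (simp add: \<alpha>_def case_prod_beta')
    show "\<forall>w\<in>Omega. integrable I (\<lambda>t. \<alpha> t w)"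
      using min admissible_integrable by (auto simp: minimizer_def)
  qed
  \<comment> \<open>Each control was changed only on a null set of times. The trajectories are still
    those of the fixed point, so the potential generated by \<open>\<alpha>\<close> is the one for
    which \<open>\<alpha>\<close> is optimal.\<close>
  have traj: "trajectory T Xs \<alpha> t w = y t (Xs w)" if t: "t \<in> {0..T}" for t w
  proof -
    have "trajectory T Xs \<alpha> t w = terminal_path T (Xs w) (optimal V (Xs w)) t"
      unfolding trajectory_eq_path \<alpha>_def
      by (rule path_cong_AE[OF borel_measurable_integrable[OF optimal_integrable[OF V]] A_meas A_ae t])
    also have "\<dots> = best_response y t (Xs w)"
      using t by (simp add: best_response_def V_def clip)
    finally show ?thesis
      by (simp add: y)
  qed
  have inter: "interaction (trajectory T Xs \<alpha>) = V"
    unfolding V_def by (intro ext) (simp add: interaction_def average_def traj)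
  have flow: "flow (trajectory T Xs \<alpha>)"
  proof -
    have "(\<lambda>(t, w). trajectory T Xs \<alpha> t w) \<in> borel_measurable (I \<Otimes>\<^sub>M W)"
      using T_pos by (intro trajectory_measurable \<alpha> Xs_measurable) simp
    moreover have "AE t in I. integrable W (\<lambda>w. \<Phi> (0 - trajectory T Xs \<alpha> t w))"
      using position_field_flow(3)[OF y(1)] by (intro AE_I2) (simp add: traj)
    moreover have "integrable I (\<lambda>t. interaction (trajectory T Xs \<alpha>) t 0)"
      using V unfolding inter by (simp add: potential_field_def)
    ultimately show ?thesis
      by (simp add: flow_def)
  qed
  have "integrable W (\<lambda>w. \<Psi> (x - trajectory T Xs \<alpha> 0 w))" for x
  proof (rule Bochner_Integration.integrable_bound)
    have t0: "0 \<in> {0..T}"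
      using T_pos by simp
    have y0: "integrable W (\<lambda>w. y 0 (Xs w))"
      by (rule position_field_flow(2)[OF y(1) t0])
    then show "integrable W (\<lambda>w. \<bar>\<Psi> x\<bar> + B' * norm (y 0 (Xs w)))"
      by simp
    have "norm (\<Psi> (x - y 0 (Xs w))) \<le> norm (\<bar>\<Psi> x\<bar> + B' * norm (y 0 (Xs w)))" for w
      using Psi_lipschitz[of "x - y 0 (Xs w)" x] by simp
    then show "AE w in W. norm (\<Psi> (x - trajectory T Xs \<alpha> 0 w)) \<le> norm (\<bar>\<Psi> x\<bar> + B' * norm (y 0 (Xs w)))"
      unfolding traj[OF t0] by (intro AE_I2)
    show "(\<lambda>w. \<Psi> (x - trajectory T Xs \<alpha> 0 w)) \<in> borel_measurable W"
      unfolding traj[OF t0] using y0 by measurable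
  qed
  with flow min show ?thesis
    unfolding inter[symmetric] using nash_equilibrium_iff[OF \<alpha>] by blast
qed

lemma nash_equilibrium_unique:
  assumes \<alpha>: "nash_equilibrium L \<Phi> \<Psi> T Xs \<alpha>" and \<beta>: "nash_equilibrium L \<Phi> \<Psi> T Xs \<beta>" and w: "w \<in> Omega"
  shows "AE t in I. \<beta> t w = \<alpha> t w"
proof -
  have cc: "collective_control T \<alpha>" "collective_control T \<beta>"
    using \<alpha> \<beta> by (auto simp: nash_equilibrium_def)
  have Z: "flow (trajectory T Xs \<beta>)" "flow (trajectory T Xs \<alpha>)"
    and min: "\<And>w. w \<in> Omega \<Longrightarrow> minimizer (interaction (trajectory T Xs \<beta>)) (Xs w) (\<lambda>t. \<beta> t w)"
      "\<And>w. w \<in> Omega \<Longrightarrow> minimizer (interaction (trajectory T Xs \<alpha>)) (Xs w) (\<lambda>t. \<alpha> t w)"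
    using \<alpha> \<beta> cc by (auto simp: nash_equilibrium_iff)
  have int: "integrable I (\<lambda>t. \<beta> t w)" "integrable I (\<lambda>t. \<alpha> t w)" if "w \<in> Omega" for w
    using cc that by (auto simp: collective_control_def)
  define S where "S = 4 * B * T\<^sup>2 / mu"
  have S: "0 \<le> S"
    using B_nonneg mu_pos by (simp add: S_def)
  \<comment> \<open>The contraction estimate applies repeatedly because both controls are best
    responses to their own flows; the case n = 0 is the bound valid for arbitrary flows.\<close>
  have bound: "norm (trajectory T Xs \<beta> t w - trajectory T Xs \<alpha> t w) \<le> rho ^ n * S"
    if "t \<in> {0..T}" "w \<in> Omega" for t w n
    using that
  proof (induction n arbitrary: t w)
    case 0
    then show ?case
      using minimizer_flow_bounded[OF Z min] by (simp add: trajectory_eq_path S_def)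
  next
    case (Suc n)
    have "(\<integral>t. norm (\<beta> t w - \<alpha> t w) \<partial>I) \<le> rho * (rho ^ n * S)"
      using Suc rho S by (intro minimizer_flow_contraction[OF Z _ _ min]) auto
    then show ?case
      using norm_path_diff_le[OF int[OF Suc.prems(2)] Suc.prems(1), of "Xs w" "Xs w"]
      by (simp add: trajectory_eq_path mult.assoc)
  qed
  have lim: "(\<lambda>n. rho ^ n * S) \<longlonglongrightarrow> 0"
    using rho by (intro tendsto_mult_left_zero LIMSEQ_power_zero) auto
  have "norm (trajectory T Xs \<beta> t w - trajectory T Xs \<alpha> t w) \<le> 0" if "t \<in> {0..T}" "w \<in> Omega" for t w
    using bound[OF that] by (intro LIMSEQ_le_const[OF lim]) auto
  \<comment> \<open>One more application, now with distance 0, passes from equal trajectories to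
    controls that agree almost everywhere.\<close>
  then have "(\<integral>t. norm (\<beta> t w - \<alpha> t w) \<partial>I) \<le> rho * 0"
    by (intro minimizer_flow_contraction[OF Z _ _ min] w) auto
  then have "(\<integral>t. norm (\<beta> t w - \<alpha> t w) \<partial>I) = 0"
    by (intro antisym) auto
  moreover have "integrable I (\<lambda>t. norm (\<beta> t w - \<alpha> t w))"
    using int[OF w] by simp
  ultimately show ?thesis
    by (subst (asm) integral_nonneg_eq_0_iff_AE) auto
qed

end

section \<open>From the data of the theorem to the game\<close>

lemma potential_conditionsD:
  assumes "potential_conditions F c"
  shows "Ck_on (Suc (Suc (Suc 0))) F UNIV" and "bdd_below (range F)"
    and "bounded_kth_derivative 1 F" and "bounded_kth_derivative 2 F"
    and "c * (norm h)\<^sup>2 \<le> inner (hess F x h) h"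
  using assms unfolding potential_conditions_def numeral_3_eq_3 by auto

lemma hess_Linf_nonneg:
  assumes "potential_conditions F c"
  shows "0 \<le> hess_Linf F"
  using onorm_hess_le[OF potential_conditionsD(1,4)[OF assms]]
    onorm_pos_le[OF has_derivative_bounded_linear[OF has_derivative_hess[OF potential_conditionsD(1)[OF assms]]]]
    order_trans by blast

theorem theorem1:
  fixes L H :: "(real ^ 'd) \<times> (real ^ 'd) \<Rightarrow> real"
    and \<Phi> \<Psi> :: "real ^ 'd \<Rightarrow> real"
    and T c0 c1 lam0 c\<Phi> c\<Psi> :: real
    and Xs :: "real \<Rightarrow> real ^ 'd"
    and u :: "real \<Rightarrow> real ^ 'd \<Rightarrow> real"
    and X :: "real \<Rightarrow> real \<Rightarrow> real ^ 'd"
  assumes T_pos: "T > 0"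
    and L_C3: "Ck_on 3 L UNIV"
    and H_C3: "Ck_on 3 H UNIV"
    and legendre_L_H: "legendre_snd L H"
    and legendre_H_L: "legendre_snd H L"
    and L_cond: "lagrangian_conditions L c0 c1 lam0"
    and Phi_cond: "potential_conditions \<Phi> c\<Phi>"
    and Psi_cond: "potential_conditions \<Psi> c\<Psi>"
    and small_T: "T\<^sup>2 * (negpart c\<Phi> + 2 * hess_Linf \<Phi>) + T * (negpart c\<Psi> + 2 * hess_Linf \<Psi>)
                    < lam0 / 2"
    and lifted_finite: "lifted_lagrangian_finite L \<Phi>"
    and Xs_L2: "Xs \<in> L2_Omega"
    and u_C1: "Ck_on 1 (\<lambda>(t, q). u t q) ({0..T} \<times> UNIV)"
    and X_C1: "Ck_on 1 (\<lambda>(t, w). X t w) ({0..T} \<times> Omega)"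
    and u_qq_bounded: "\<exists>C. \<forall>t\<in>{0..T}. \<forall>q.
           (\<exists>D. GDERIV (u t) q :> D) \<and> grad (u t) differentiable (at q) \<and> onorm (hess (u t) q) \<le> C"
    and system: "mfg_system T H \<Phi> \<Psi> Xs u X"
    and non_atomic: "\<forall>q. {w \<in> Omega. Xs w = q} \<in> null_sets lebesgue"
  shows "\<exists>\<alpha>. nash_equilibrium L \<Phi> \<Psi> T Xs \<alpha> \<and>
           (\<forall>\<beta>. nash_equilibrium L \<Phi> \<Psi> T Xs \<beta> \<longrightarrow>
              (\<forall>w\<in>Omega. AE t in lebesgue_on {0..T}. \<beta> t w = \<alpha> t w))"
proof -
  note Phi = potential_conditionsD[OF Phi_cond] and Psi = potential_conditionsD[OF Psi_cond]
  have L: "Ck_on (Suc (Suc (Suc 0))) L UNIV"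
    using L_C3 by (simp only: numeral_3_eq_3)
  obtain B where B: "B \<ge> 0" "\<And>x y. \<bar>\<Phi> x - \<Phi> y\<bar> \<le> B * norm (x - y)"
    using potential_lipschitz[OF Phi(1,3)] by blast
  obtain B' where B': "B' \<ge> 0" "\<And>x y. \<bar>\<Psi> x - \<Psi> y\<bar> \<le> B' * norm (x - y)"
    using potential_lipschitz[OF Psi(1,3)] by blast
  obtain m where m: "\<And>x. m \<le> \<Phi> x"
    using Phi(2) by (auto simp: bdd_below_def)
  let ?K = "hess_Linf \<Phi>"
  have K: "0 \<le> ?K" "0 \<le> hess_Linf \<Psi>"
    using hess_Linf_nonneg Phi_cond Psi_cond by auto
  have lam0: "0 < lam0"
    using L_cond by (simp add: lagrangian_conditions_def)
  have "0 \<le> T * (negpart c\<Psi> + 2 * hess_Linf \<Psi>)"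
    using T_pos K by (intro mult_nonneg_nonneg add_nonneg_nonneg) auto
  \<comment> \<open>This is the contraction condition \<open>2 * ?K * T\<^sup>2 < mu\<close> with
    \<open>mu\<close> unfolded.\<close>
  with small_T lam0 have small: "T\<^sup>2 * negpart c\<Phi> + 2 * ?K * T\<^sup>2 < lam0"
    by (simp only: distrib_left mult.assoc mult.commute[of "T\<^sup>2"])
  have KT: "0 \<le> 2 * ?K * T\<^sup>2"
    using K by simp
  interpret control_problem L T c0 c1 lam0 "negpart c\<Phi>" B "max 0 (- m)"
  proof
    show "continuous_on UNIV L"
      using Ck_on_SucD(1)[OF L] by (intro continuous_at_imp_continuous_on ballI differentiable_imp_continuous_within)
    show "2 * L ((1/2) *\<^sub>R (x + y), (1/2) *\<^sub>R (v + w)) \<le> L (x, v) + L (y, w) - lam0 / 4 * (norm (v - w))\<^sup>2" for x y v w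
      using lagrangian_midpoint[OF L L_cond, of "(x, v)" "(y, w)"] by simp
    show "\<bar>L (x, v) - L (y, v)\<bar> \<le> c1 * norm (x - y)" for x y v
      by (rule lagrangian_lipschitz[OF L L_cond])
    show "T\<^sup>2 * negpart c\<Phi> < lam0"
      using small KT by linarith
  qed (use T_pos B L_cond in \<open>auto simp: lagrangian_conditions_def\<close>)
  have Omega: "finite_measure (lebesgue_on Omega)"
    by (intro finite_measure_lebesgue_on) auto
  have Xs: "Xs \<in> borel_measurable (lebesgue_on Omega)" "integrable (lebesgue_on Omega) (\<lambda>w. (norm (Xs w))\<^sup>2)"
    using Xs_L2 by (simp_all add: L2_Omega_def)
  interpret nash_game L T c0 c1 lam0 "negpart c\<Phi>" B "max 0 (- m)" \<Phi> ?K Xs \<Psi> B'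
  proof
    show "- max 0 (- m) \<le> \<Phi> x" for x
      using m[of x] by linarith
    show "2 * \<Phi> ((1/2) *\<^sub>R (x + y)) \<le> \<Phi> x + \<Phi> y + negpart c\<Phi> / 4 * (norm (x - y))\<^sup>2" for x y
      by (rule potential_midpoint[OF Phi(1,5)])
    show "\<bar>(\<Phi> (x - a) - \<Phi> (x - b)) - (\<Phi> (y - a) - \<Phi> (y - b))\<bar> \<le> ?K * norm (a - b) * norm (x - y)" for x y a b
      by (rule potential_second_difference[OF Phi(1,4)])
    show "2 * ?K * T\<^sup>2 < mu"
      using small by (simp add: mu_def)
    show "integrable (lebesgue_on Omega) Xs"
      by (rule finite_measure.square_integral_norm_le(1)[OF Omega Xs])
  qed (use B B' K Xs(1) non_atomic in auto)
  obtain \<alpha> where \<alpha>: "nash_equilibrium L \<Phi> \<Psi> T Xs \<alpha>"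
    using nash_equilibrium_exists ..
  show ?thesis
    by (intro exI[of _ \<alpha>] conjI allI impI ballI \<alpha> nash_equilibrium_unique[OF \<alpha>])
qed

end
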